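(* Let $q\neq1$ be a power of a prime $p$. For $f\in\mathbb{F}_q[X]$ let $\omega(f)$ denote the number of monic irreducible polynomials dividing $f$, and for nonzero $g\in\mathbb{F}_q[X]$ write $|g|=q^{\deg(g)}$. Then for every $u\in\mathbb{R}$, $$\lim_{d\to+\infty}\frac{\exp((1-e^{iu})\log d)}{q^d}\sum_{\deg(f)=d}e^{iu(\omega(f)-1)}=\tilde\Phi_1(u)\tilde\Phi_2(u),$$ where $$\tilde\Phi_1(u)=\frac{1}{\Gamma(e^{iu}+1)},\qquad \tilde\Phi_2(u)=\prod_{\pi}\Bigl(1-\frac{1}{|\pi|}\Bigr)^{e^{iu}}\Bigl(1+\frac{e^{iu}}{|\pi|-1}\Bigr),$$ the product running over all monic irreducible polynomials $\pi\in\mathbb{F}_q[X]$ and the sum over all monic polynomials $f\in\mathbb{F}_q[X]$ of degree $d$. Moreover, the convergence is uniform in $u\in\mathbb{R}$. *)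

theory Defs
  imports "HOL-Analysis.Analysis" "HOL-Computational_Algebra.Computational_Algebra"
begin

text \<open>
  The field \<open>\<bbbF>\<^sub>q\<close> is a type \<open>'a\<close> of class \<open>{field, finite}\<close>, with \<open>q = CARD('a)\<close>.
\<close>

definition monic_irreducibles :: "'a::field poly set" where
  "monic_irreducibles = {\<pi>. lead_coeff \<pi> = 1 \<and> irreducible \<pi>}"

definition monic_of_degree :: "nat \<Rightarrow> 'a::field poly set" where
  "monic_of_degree d = {f. lead_coeff f = 1 \<and> degree f = d}"

definition omega :: "'a::field poly \<Rightarrow> nat" where
  "omega f = card {\<pi> \<in> monic_irreducibles. \<pi> dvd f}"

definition poly_abs :: "'a::{field,finite} poly \<Rightarrow> real" where
  "poly_abs g = real CARD('a) ^ degree g"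

text \<open>
  Unordered infinite products over an arbitrary index set, in the style of \<^const>\<open>infsum\<close>.
  As for \<^const>\<open>convergent_prod\<close>, convergence requires that, after removal of finitely many
  factors, the remaining partial products tend to a nonzero limit. The product may
  nevertheless be zero, because of a removed zero factor.
\<close>

definition uprod_convergent :: "('i \<Rightarrow> complex) \<Rightarrow> 'i set \<Rightarrow> bool" where
  "uprod_convergent f A \<longleftrightarrow>
     (\<exists>F\<^sub>0 P. finite F\<^sub>0 \<and> F\<^sub>0 \<subseteq> A \<and> P \<noteq> 0 \<and>
        ((\<lambda>F. \<Prod>i\<in>F. f i) \<longlongrightarrow> P) (finite_subsets_at_top (A - F\<^sub>0)))"

definition uprod :: "('i \<Rightarrow> complex) \<Rightarrow> 'i set \<Rightarrow> complex" where
  "uprod f A = Lim (finite_subsets_at_top A) (\<lambda>F. \<Prod>i\<in>F. f i)"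

text \<open>
  \<^const>\<open>rGamma\<close> is the entire function \<open>1/\<Gamma>\<close>; in particular \<open>Phi1 u = 0\<close> when \<open>e\<^sup>i\<^sup>u = -1\<close>,
  where \<open>\<Gamma>\<close> has a pole.
\<close>

definition Phi1 :: "real \<Rightarrow> complex" where
  "Phi1 u = rGamma (exp (\<i> * of_real u) + 1)"

text \<open>
  The base \<open>1 - 1/\<bar>\<pi>\<bar>\<close> is a positive real, so that the principal branch used by \<open>powr\<close>
  is the power given by the real logarithm.
\<close>

definition Phi2_factor :: "real \<Rightarrow> 'a::{field,finite} poly \<Rightarrow> complex" where
  "Phi2_factor u \<pi> =
     complex_of_real (1 - 1 / poly_abs \<pi>) powr exp (\<i> * of_real u) *
     (1 + exp (\<i> * of_real u) / of_real (poly_abs \<pi> - 1))"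

definition Phi2 :: "'a::{field,finite} itself \<Rightarrow> real \<Rightarrow> complex" where
  "Phi2 _ u = uprod (Phi2_factor u) (monic_irreducibles :: 'a poly set)"

end

theory Submission
  imports Defs
begin

text \<open>
  Write \<open>z = e\<^sup>i\<^sup>u\<close>. The generating series \<open>\<Sum>\<^sub>f z\<^bsup>\<omega>(f)\<^esup> T\<^bsup>deg f\<^esup>\<close> is the Euler product of the factors
  \<open>1 + z X / (1 - X)\<close> with \<open>X = T\<^bsup>deg \<pi>\<^esup>\<close>, and hence equals \<open>(1 - q T)\<^bsup>-z\<^esup> G(T)\<close>, where \<open>G\<close> is the
  product of the factors \<open>(1 - X)\<^sup>z (1 + z X / (1 - X)) = 1 + O(X\<^sup>2)\<close>. So \<open>G\<close> converges absolutely
  on a disc of radius \<open>r > 1/q\<close>, uniformly in \<open>u\<close>, and \<open>G(1/q)\<close> is the infinite product of the theorem.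
  The \<open>n\<close>-th coefficient of \<open>(1 - q T)\<^bsup>-z\<^esup>\<close> is asymptotic to \<open>q\<^sup>n n\<^bsup>z-1\<^esup> / \<Gamma>(z)\<close>, uniformly
  on the unit circle, and convolving it with the coefficients of \<open>G\<close> multiplies the limit
  by \<open>G(1/q)\<close>. Only finitely many irreducibles matter in each degree, so all products of power
  series can be taken finite.
\<close>

unbundle no vec_syntax
unbundle fps_syntax

subsection \<open>Monic polynomials over a finite field\<close>

text \<open>The exponent \<open>omega f - 1\<close> contributes a factor 1/z, and 1/(z \<Gamma>(z))
  = 1/\<Gamma>(z+1) accounts for the argument of \<open>Phi1\<close>. The unit circle contains z =
  -1, a pole of \<Gamma>(z+1), so the estimates use Pochhammer symbols and the entire function
  \<open>rGamma\<close>, never \<Gamma> itself. Finite Euler products have two costs. The product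
  for z = 1 agrees with 1/(1 - qT) only up to degree d, so its z-th power must be described in a way
  that is local in the coefficients; a differential equation does this. And the correction series G
  now varies with d, so the limit inside the convolution needs a bound free of d and u. This bound
  is \<Sum> |g_m| r^m \<le> B for one fixed r with 1/q < r < 1/sqrt q. The upper end comes from
  comparing the sum of r^(2 deg \<pi>) over irreducibles with \<Sum> (q r^2)^n, as there are q^n
  monic polynomials of degree n. The lower end leaves a geometric weight (1/(qr))^m, which absorbs
  the factor (m+1)^2 lost when the coefficient of index d - m is normalised by d instead of d -
  m.\<close>

lemma monic_of_degree_0: "monic_of_degree 0 = {1 :: 'a::field poly}"
proof -
  have "f = 1" if "lead_coeff f = 1" "degree f = 0" for f :: "'a poly"
    using that by (metis degree_eq_zeroE lead_coeff_pCons(2) one_pCons)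
  then show ?thesis by (auto simp: monic_of_degree_def)
qed

lemma monic_of_degree_Suc:
  "monic_of_degree (Suc d) = (\<lambda>(c, f). pCons c f) ` (UNIV \<times> monic_of_degree d)"
proof -
  have "\<exists>c g. f = pCons c g \<and> lead_coeff g = 1 \<and> degree g = d"
    if "lead_coeff f = 1" "degree f = Suc d" for f :: "'a::field poly"
    using that by (cases f) (auto split: if_splits)
  then show ?thesis
    by (fastforce simp: monic_of_degree_def image_iff)
qed

lemma finite_monic_of_degree: "finite (monic_of_degree d :: 'a::{field,finite} poly set)"
  by (induction d) (auto simp: monic_of_degree_0 monic_of_degree_Suc)

lemma card_monic_of_degree:
  "card (monic_of_degree d :: 'a::{field,finite} poly set) = CARD('a) ^ d"
proof (induction d)
  case (Suc d)
  have "inj_on (\<lambda>(c, f). pCons c f) (UNIV \<times> (monic_of_degree d :: 'a poly set))"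
    by (auto simp: inj_on_def)
  then show ?case
    by (simp add: monic_of_degree_Suc card_image card_cartesian_product Suc.IH)
qed (simp add: monic_of_degree_0)

lemma monic_irreducible_degree_pos: "\<pi> \<in> monic_irreducibles \<Longrightarrow> degree \<pi> > 0"
  for \<pi> :: "'a::field poly"
  by (auto simp: monic_irreducibles_def irreducible_def is_unit_iff_degree)

lemma finite_degree_le_monic_irreducibles:
  "finite {\<pi> \<in> monic_irreducibles :: 'a::{field,finite} poly set. degree \<pi> \<le> N}"
proof (rule finite_subset)
  show "{\<pi> \<in> monic_irreducibles :: 'a poly set. degree \<pi> \<le> N} \<subseteq> (\<Union>d\<le>N. monic_of_degree d)"
    by (auto simp: monic_irreducibles_def monic_of_degree_def)
qed (auto intro: finite_monic_of_degree)

lemma monic_dvd_degree_le: "lead_coeff f = 1 \<Longrightarrow> g dvd f \<Longrightarrow> degree g \<le> degree f"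
  for f :: "'a::field poly"
  by (metis dvd_imp_degree_le leading_coeff_0_iff zero_neq_one)

lemma finite_monic_irreducible_divisors:
  "lead_coeff f = 1 \<Longrightarrow> finite {\<pi> \<in> monic_irreducibles. \<pi> dvd f}"
  for f :: "'a::{field,finite} poly"
  by (rule finite_subset[OF _ finite_degree_le_monic_irreducibles[of "degree f"]])
     (auto dest: monic_dvd_degree_le)

lemma monic_dvd_cofactor:
  fixes f g :: "'a::field poly"
  assumes "lead_coeff f = 1" "lead_coeff g = 1" "g dvd f"
  obtains h where "lead_coeff h = 1" "f = g * h" "degree f = degree g + degree h"
proof -
  obtain h where h: "f = g * h" using assms(3) by blast
  have "g \<noteq> 0" "h \<noteq> 0" using assms h by auto
  moreover have "lead_coeff h = 1" using assms h by (simp add: lead_coeff_mult)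
  ultimately show ?thesis using that h by (auto simp: degree_mult_eq)
qed

lemma ex_monic_irreducible_dvd:
  fixes f :: "'a::field poly"
  assumes "lead_coeff f = 1" "degree f > 0"
  shows "\<exists>\<pi>\<in>monic_irreducibles. \<pi> dvd f"
  using assms
proof (induction "degree f" arbitrary: f rule: less_induct)
  case less
  show ?case
  proof (cases "irreducible f")
    case True
    then show ?thesis using less.prems by (auto simp: monic_irreducibles_def)
  next
    case False
    have f0: "f \<noteq> 0" using less.prems by auto
    have "\<not> f dvd 1" using less.prems by (auto simp: is_unit_iff_degree f0)
    then obtain a b where ab: "f = a * b" "\<not> a dvd 1" "\<not> b dvd 1"
      using False f0 unfolding irreducible_def by blast
    have a0: "a \<noteq> 0" "b \<noteq> 0" using ab f0 by auto
    define c where "c = smult (inverse (lead_coeff a)) a"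
    have "degree a > 0" "degree b > 0" using ab a0 by (auto simp: is_unit_iff_degree)
    then have "degree c < degree f" "degree c > 0" "lead_coeff c = 1"
      using a0 ab by (auto simp: c_def degree_mult_eq)
    then obtain \<pi> where "\<pi> \<in> monic_irreducibles" "\<pi> dvd c" using less.hyps by blast
    moreover have "c dvd f" using a0 ab unfolding c_def
      by (intro smult_dvd) auto
    ultimately show ?thesis using dvd_trans by blast
  qed
qed

lemma monic_irreducible_dvd_eq:
  fixes \<sigma> \<pi> :: "'a::field poly"
  assumes "\<sigma> \<in> monic_irreducibles" "\<pi> \<in> monic_irreducibles" "\<sigma> dvd \<pi>"
  shows "\<sigma> = \<pi>"
proof -
  have l: "lead_coeff \<pi> = 1" "lead_coeff \<sigma> = 1" using assms by (auto simp: monic_irreducibles_def)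
  obtain h where h: "lead_coeff h = 1" "\<pi> = \<sigma> * h" using monic_dvd_cofactor[OF l assms(3)] by metis
  have "\<not> \<sigma> dvd 1" using assms(1) by (auto simp: monic_irreducibles_def irreducible_def)
  then have "h dvd 1" using assms(2) h(2) by (auto simp: monic_irreducibles_def irreducible_def)
  then have "degree h = 0" using h(1) by (metis is_unit_iff_degree dvd_0_left_iff zero_neq_one)
  then have "h = 1" using h(1) monic_of_degree_0 unfolding monic_of_degree_def by blast
  then show ?thesis using h by simp
qed

lemma monic_irreducible_dvd_mult:
  fixes \<sigma> :: "'a::field poly"
  assumes "\<sigma> \<in> monic_irreducibles"
  shows "\<sigma> dvd f * g \<longleftrightarrow> \<sigma> dvd f \<or> \<sigma> dvd g"
  using assms field_poly_irreducible_imp_prime[of \<sigma>]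
  by (auto simp: monic_irreducibles_def prime_elem_dvd_mult_iff)

text \<open>Multiplicity is ignored, so only the first factor \<pi> is counted. Together with
  \<open>omega_1\<close> this is all that the Euler product uses about \<open>omega\<close>.\<close>

lemma omega_mult_monic_irreducible:
  fixes \<pi> g :: "'a::{field,finite} poly"
  assumes "\<pi> \<in> monic_irreducibles" "lead_coeff g = 1"
  shows "omega (\<pi> * g) = (if \<pi> dvd g then omega g else Suc (omega g))"
proof -
  have "{\<sigma> \<in> monic_irreducibles. \<sigma> dvd \<pi> * g} = insert \<pi> {\<sigma> \<in> monic_irreducibles. \<sigma> dvd g}"
    using assms(1) by (auto simp: monic_irreducible_dvd_mult dest: monic_irreducible_dvd_eq)
  then show ?thesis
    using finite_monic_irreducible_divisors[OF assms(2)] assms(1)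
    by (auto simp: omega_def card_insert_if)
qed

lemma omega_1: "omega (1 :: 'a::field poly) = 0"
proof -
  have "{\<pi> \<in> monic_irreducibles :: 'a poly set. \<pi> dvd 1} = {}"
    by (auto simp: monic_irreducibles_def irreducible_def)
  then show ?thesis unfolding omega_def by (simp only: card.empty)
qed

subsection \<open>Euler products\<close>

definition smooth_monic :: "'a::field poly set \<Rightarrow> nat \<Rightarrow> 'a poly set" where
  "smooth_monic P d = {f \<in> monic_of_degree d. \<forall>\<pi>\<in>monic_irreducibles. \<pi> dvd f \<longrightarrow> \<pi> \<in> P}"

definition omega_series :: "complex \<Rightarrow> 'a::field poly set \<Rightarrow> complex fps" where
  "omega_series z P = Abs_fps (\<lambda>d. \<Sum>f\<in>smooth_monic P d. z ^ omega f)"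

text \<open>This is 1 + z X / (1 - X): every positive power of an irreducible has weight z. At z = 1
  it is the geometric series 1 / (1 - X).\<close>

definition local_series :: "complex \<Rightarrow> complex fps" where
  "local_series z = Abs_fps (\<lambda>k. if k = 0 then 1 else z)"

lemma finite_smooth_monic [simp]: "finite (smooth_monic P d :: 'a::{field,finite} poly set)"
  by (rule finite_subset[OF _ finite_monic_of_degree[of d]]) (auto simp: smooth_monic_def)

lemma omega_series_empty: "omega_series z ({} :: 'a::field poly set) = 1"
proof (rule fps_ext)
  fix d
  have "f = 1" if "lead_coeff f = 1" "degree f = d" "\<forall>\<pi>\<in>monic_irreducibles. \<not> \<pi> dvd f" for f :: "'a poly"
    using that ex_monic_irreducible_dvd[of f] monic_of_degree_0 unfolding monic_of_degree_def by blast
  moreover have "\<not> \<pi> dvd 1" if "\<pi> \<in> monic_irreducibles" for \<pi> :: "'a poly"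
    using that by (auto simp: monic_irreducibles_def irreducible_def)
  ultimately have "f \<in> smooth_monic ({} :: 'a poly set) d \<longleftrightarrow> f = 1 \<and> d = 0" for f
    unfolding smooth_monic_def monic_of_degree_def mem_Collect_eq
    by (metis degree_1 empty_iff lead_coeff_1)
  then have "smooth_monic ({} :: 'a poly set) d = (if d = 0 then {1} else {})"
    by auto
  then show "omega_series z ({} :: 'a poly set) $ d = 1 $ d"
    by (simp add: omega_series_def omega_1)
qed

lemma smooth_monic_insert_dvd:
  fixes \<pi> :: "'a::{field,finite} poly"
  assumes \<pi>: "\<pi> \<in> monic_irreducibles" "\<pi> \<notin> P"
  shows "{f \<in> smooth_monic (insert \<pi> P) d. \<pi> dvd f} =
    (if d < degree \<pi> then {} else (*) \<pi> ` smooth_monic (insert \<pi> P) (d - degree \<pi>))"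
proof -
  have l: "lead_coeff \<pi> = 1" "\<pi> \<noteq> 0" using \<pi> by (auto simp: monic_irreducibles_def)
  show ?thesis
  proof (cases "d < degree \<pi>")
    case True
    then show ?thesis
      by (fastforce simp: smooth_monic_def monic_of_degree_def dest: monic_dvd_degree_le)
  next
    case False
    have "f \<in> (*) \<pi> ` smooth_monic (insert \<pi> P) (d - degree \<pi>)"
      if f: "f \<in> smooth_monic (insert \<pi> P) d" "\<pi> dvd f" for f
    proof -
      have "lead_coeff f = 1" using f by (auto simp: smooth_monic_def monic_of_degree_def)
      then obtain h where "lead_coeff h = 1" "f = \<pi> * h" "degree f = degree \<pi> + degree h"
        using monic_dvd_cofactor l f by metis
      then show ?thesis using f by (auto simp: smooth_monic_def monic_of_degree_def intro!: image_eqI[of _ _ h])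
    qed
    moreover have "\<pi> * h \<in> smooth_monic (insert \<pi> P) d"
      if h: "h \<in> smooth_monic (insert \<pi> P) (d - degree \<pi>)" for h
    proof -
      have "lead_coeff h = 1" using h by (auto simp: smooth_monic_def monic_of_degree_def)
      then have "h \<noteq> 0" by auto
      have "\<sigma> \<in> insert \<pi> P" if "\<sigma> \<in> monic_irreducibles" "\<sigma> dvd \<pi> * h" for \<sigma>
        using that \<pi> h monic_irreducible_dvd_eq[OF that(1) \<pi>(1)] monic_irreducible_dvd_mult[OF that(1)]
        by (auto simp: smooth_monic_def)
      moreover have "degree (\<pi> * h) = d"
        using h l \<open>h \<noteq> 0\<close> False by (auto simp: smooth_monic_def monic_of_degree_def degree_mult_eq)
      moreover have "lead_coeff (\<pi> * h) = 1"
        using \<open>lead_coeff h = 1\<close> l by (simp only: lead_coeff_mult mult_1)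
      ultimately show ?thesis unfolding smooth_monic_def monic_of_degree_def by blast
    qed
    ultimately show ?thesis using False by auto
  qed
qed

text \<open>The series A' for \<open>insert \<pi> P\<close> splits as A + D, where D collects the
  multiples of \<pi>. Removing a single factor \<pi> leaves any polynomial over
  \<open>insert \<pi> P\<close>, possibly again a multiple of \<pi>, and lowers \<open>omega\<close>
  exactly when the cofactor is prime to \<pi>. Hence D = X^n (z A + D), and eliminating D gives (1 -
  X^n) A' = (1 + (z - 1) X^n) A. The local factor satisfies the same equation with A replaced by 1,
  and 1 - X^n can be cancelled.\<close>

lemma omega_series_insert:
  fixes \<pi> :: "'a::{field,finite} poly"
  assumes \<pi>: "\<pi> \<in> monic_irreducibles" "\<pi> \<notin> P"
  shows "omega_series z (insert \<pi> P) = omega_series z P * (local_series z oo fps_X ^ degree \<pi>)"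
proof -
  define n where "n = degree \<pi>"
  have n: "n > 0" using \<pi> monic_irreducible_degree_pos by (auto simp: n_def)
  define A where "A = omega_series z P"
  define A' where "A' = omega_series z (insert \<pi> P)"
  define D where "D = Abs_fps (\<lambda>d. \<Sum>f | f \<in> smooth_monic (insert \<pi> P) d \<and> \<pi> dvd f. z ^ omega f)"
  have nd: "{f \<in> smooth_monic (insert \<pi> P) d. \<not> \<pi> dvd f} = smooth_monic P d" for d
    using \<pi> by (auto simp: smooth_monic_def)
  have split: "(\<Sum>f\<in>smooth_monic (insert \<pi> P) d. F f) =
      (\<Sum>f | f \<in> smooth_monic (insert \<pi> P) d \<and> \<pi> dvd f. F f) + (\<Sum>f\<in>smooth_monic P d. F f)"
    for F :: "'a poly \<Rightarrow> complex" and d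
    using sum.Int_Diff[of "smooth_monic (insert \<pi> P) d" F "{f. \<pi> dvd f}"]
    by (simp flip: nd add: Int_def set_diff_eq)
  have AD: "A' = A + D"
    by (rule fps_ext) (simp add: A'_def A_def D_def omega_series_def split)
  have D: "D = fps_X ^ n * (fps_const z * A + D)"
  proof (rule fps_ext)
    fix d
    have inj: "inj_on ((*) \<pi>) S" for S using \<pi> by (auto simp: inj_on_def monic_irreducibles_def)
    show "D $ d = (fps_X ^ n * (fps_const z * A + D)) $ d"
    proof (cases "d < n")
      case True
      then show ?thesis
        by (simp add: D_def smooth_monic_insert_dvd[OF \<pi>] fps_X_power_mult_nth n_def)
    next
      case False
      have om: "omega (\<pi> * g) = (if \<pi> dvd g then omega g else Suc (omega g))"
        if "g \<in> smooth_monic (insert \<pi> P) e" for g e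
        using omega_mult_monic_irreducible[OF \<pi>(1), of g] that
        by (auto simp: smooth_monic_def monic_of_degree_def)
      have "D $ d = (\<Sum>g\<in>smooth_monic (insert \<pi> P) (d - n). z ^ omega (\<pi> * g))"
        using False by (simp add: D_def smooth_monic_insert_dvd[OF \<pi>] n_def sum.reindex[OF inj])
      also have "\<dots> = D $ (d - n) + (\<Sum>g\<in>smooth_monic P (d - n). z * z ^ omega g)"
        unfolding split D_def using \<pi>
        by (simp, intro arg_cong2[where f="(+)"] sum.cong) (auto simp: om nd[symmetric])
      also have "\<dots> = (fps_X ^ n * (fps_const z * A + D)) $ d"
        using False by (simp add: fps_X_power_mult_nth A_def omega_series_def sum_distrib_left)
      finally show ?thesis .
    qed
  qed
  define L where "L = local_series z oo fps_X ^ n"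
  have "(1 - fps_X) * local_series z = 1 + fps_const (z - 1) * fps_X"
    by (rule fps_ext) (auto simp: local_series_def left_diff_distrib fps_X_mult_nth fps_X_nth)
  then have "((1 - fps_X) * local_series z) oo fps_X ^ n = (1 + fps_const (z - 1) * fps_X) oo fps_X ^ n"
    by simp
  moreover have X0: "(fps_X ^ n :: complex fps) $ 0 = 0" using n by simp
  ultimately have L: "(1 - fps_X ^ n) * L = 1 + fps_const (z - 1) * fps_X ^ n"
    by (simp add: L_def fps_compose_mult_distrib[OF X0] fps_compose_sub_distrib fps_compose_add_distrib)
  have "(1 - fps_X ^ n) * A' = A * (1 + fps_const (z - 1) * fps_X ^ n)"
    using D unfolding AD by (simp add: algebra_simps fps_const_sub[symmetric] del: fps_const_sub)
  also have "\<dots> = (1 - fps_X ^ n) * (A * L)" by (subst L[symmetric]) (simp only: mult_ac)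
  finally have "A' = A * L"
  proof -
    have "(1 - fps_X ^ n :: complex fps) $ 0 \<noteq> 0" using n by simp
    then have "(1 - fps_X ^ n :: complex fps) \<noteq> 0" by (metis fps_zero_nth)
    then show "(1 - fps_X ^ n) * A' = (1 - fps_X ^ n) * (A * L) \<Longrightarrow> ?thesis" by simp
  qed
  then show ?thesis by (simp add: A'_def A_def L_def n_def)
qed

lemma omega_series_eq_prod:
  fixes P :: "'a::{field,finite} poly set"
  assumes "finite P" "P \<subseteq> monic_irreducibles"
  shows "omega_series z P = (\<Prod>\<pi>\<in>P. local_series z oo fps_X ^ degree \<pi>)"
  using assms
  by (induction P rule: finite_induct) (auto simp: omega_series_empty omega_series_insert mult_ac)

section \<open>Truncation to irreducibles of bounded degree\<close>

definition irreducibles_upto :: "nat \<Rightarrow> 'a::field poly set" where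
  "irreducibles_upto N = {\<pi> \<in> monic_irreducibles. degree \<pi> \<le> N}"

lemma irreducibles_upto_subset: "irreducibles_upto N \<subseteq> monic_irreducibles"
  by (auto simp: irreducibles_upto_def)

lemma finite_irreducibles_upto [simp]: "finite (irreducibles_upto N :: 'a::{field,finite} poly set)"
  by (simp add: irreducibles_upto_def finite_degree_le_monic_irreducibles)

lemma smooth_monic_irreducibles_upto:
  "d \<le> N \<Longrightarrow> smooth_monic (irreducibles_upto N) d = monic_of_degree d"
  by (fastforce simp: smooth_monic_def irreducibles_upto_def monic_of_degree_def dest: monic_dvd_degree_le)

lemma omega_series_irreducibles_upto_nth:
  "d \<le> N \<Longrightarrow> omega_series z (irreducibles_upto N :: 'a::field poly set) $ d =
     (\<Sum>f\<in>(monic_of_degree d :: 'a poly set). z ^ omega f)"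
  by (simp add: omega_series_def smooth_monic_irreducibles_upto)

subsection \<open>Complex powers of power series\<close>

text \<open>This is (1 - X)^z. The series of interest is \<open>binomial_series (- z)\<close>, whose
  coefficients are the Pochhammer quotients below.\<close>

definition binomial_series :: "complex \<Rightarrow> complex fps" where
  "binomial_series z = fps_binomial z oo (- fps_X)"

lemma binomial_series_nth: "binomial_series z $ n = (-1) ^ n * (z gchoose n)"
proof -
  have "fps_binomial z oo (fps_const (-1) * fps_X) = binomial_series z"
    unfolding binomial_series_def by (simp flip: fps_const_neg)
  then show ?thesis by (metis fps_nth_compose_linear fps_binomial_nth)
qed

lemma binomial_series_nth_uminus: "binomial_series (- z) $ n = pochhammer z n / fact n"
  by (simp add: binomial_series_nth gbinomial_pochhammer flip: power_mult_distrib)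

lemma binomial_series_mult_uminus: "binomial_series z * binomial_series (- z) = 1"
  by (simp add: binomial_series_def flip: fps_compose_mult_distrib fps_binomial_add_mult)

text \<open>\<open>D = A\<^sup>z\<close>, expressed by \<open>D' / D = z A' / A\<close>.\<close>

definition is_fps_power :: "complex \<Rightarrow> complex fps \<Rightarrow> complex fps \<Rightarrow> bool" where
  "is_fps_power z A D \<longleftrightarrow> fps_deriv D * A = fps_const z * fps_deriv A * D"

lemma fps_prod_nth_zero: "(\<Prod>i\<in>I. f i) $ 0 = (\<Prod>i\<in>I. f i $ 0 :: 'b::comm_ring_1)"
  by (induction I rule: infinite_finite_induct) auto

lemma is_fps_power_1: "is_fps_power z 1 1"
  by (simp add: is_fps_power_def)

lemma is_fps_power_mult:
  assumes "is_fps_power z A D" "is_fps_power z B E"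
  shows "is_fps_power z (A * B) (D * E)"
proof -
  have "fps_deriv (D * E) * (A * B) = (fps_deriv D * A) * (E * B) + (fps_deriv E * B) * (D * A)"
    by (simp add: algebra_simps)
  also have "\<dots> = fps_const z * fps_deriv (A * B) * (D * E)"
    using assms unfolding is_fps_power_def by (simp only:) (simp add: algebra_simps)
  finally show ?thesis by (simp add: is_fps_power_def)
qed

lemma is_fps_power_prod:
  "(\<And>i. i \<in> I \<Longrightarrow> is_fps_power z (A i) (D i)) \<Longrightarrow> is_fps_power z (\<Prod>i\<in>I. A i) (\<Prod>i\<in>I. D i)"
  by (induction I rule: infinite_finite_induct) (auto intro: is_fps_power_1 is_fps_power_mult)

lemma is_fps_power_compose:
  assumes "is_fps_power z A D" "g $ 0 = 0"
  shows "is_fps_power z (A oo g) (D oo g)"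
proof -
  have "(fps_deriv D * A) oo g = (fps_const z * fps_deriv A * D) oo g"
    using assms by (simp add: is_fps_power_def)
  then have "(fps_deriv D oo g) * (A oo g) * fps_deriv g = fps_const z * (fps_deriv A oo g) * (D oo g) * fps_deriv g"
    by (simp add: fps_compose_mult_distrib[OF assms(2)] )
  then show ?thesis
    by (simp add: is_fps_power_def fps_compose_deriv[OF assms(2)] mult_ac)
qed

text \<open>Here \<open>local_series 1\<close> is L = 1/(1 - X), so the claim is that F = (1 -
  X)^(-z) is its z-th power. It follows from F' (1 - X) = z F and L' (1 - X) = L after cancelling 1
  - X.\<close>

lemma is_fps_power_binomial_series: "is_fps_power z (local_series 1) (binomial_series (- z))"
proof -
  have inv: "(1 - fps_X) * local_series 1 = 1"
    by (rule fps_ext) (auto simp: local_series_def left_diff_distrib fps_X_mult_nth fps_X_nth)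
  have "fps_deriv (binomial_series (-z)) * (1 - fps_X) = fps_const z * binomial_series (-z)"
    unfolding fps_eq_iff
  proof
    fix n
    have "(pochhammer z (Suc n) / fact (Suc n) * of_nat (Suc n)) = pochhammer z n / fact n * (z + of_nat n)"
      by (simp add: pochhammer_rec' field_simps del: of_nat_Suc)
    then show "(fps_deriv (binomial_series (-z)) * (1 - fps_X)) $ n = (fps_const z * binomial_series (-z)) $ n"
      by (cases n) (simp_all add: right_diff_distrib binomial_series_nth_uminus algebra_simps add_divide_distrib del: of_nat_Suc fact_Suc)
  qed
  moreover have "fps_deriv (local_series 1) * (1 - fps_X) = local_series 1"
    by (rule fps_ext) (auto simp: right_diff_distrib local_series_def)
  ultimately have "fps_deriv (binomial_series (-z)) * (1 - fps_X) * local_series 1 =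
     fps_const z * (fps_deriv (local_series 1) * (1 - fps_X)) * binomial_series (-z)"
    by (simp add: mult_ac)
  then have "(1 - fps_X) * (fps_deriv (binomial_series (-z)) * local_series 1) =
     (1 - fps_X) * (fps_const z * fps_deriv (local_series 1) * binomial_series (-z))"
    by (simp add: mult_ac)
  moreover have "(1 - fps_X :: complex fps) \<noteq> 0" using inv by auto
  ultimately show ?thesis unfolding is_fps_power_def by simp
qed

text \<open>A z-th power up to degree N depends only on its base up to degree N. In the coefficient
  of X^m of D' A = z A' D, the highest coefficient of D occurs once, as (m+1) D_(m+1) A_0 with A_0 =
  1; everything else involves lower coefficients of D and coefficients of A of index at most m + 1.
  This recursion determines D from D_0.\<close>

lemma is_fps_power_nth_eq:
  assumes D: "is_fps_power z A D" and E: "is_fps_power z B E"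
    and 0: "A $ 0 = 1" "D $ 0 = E $ 0"
    and eq: "\<And>i. i \<le> N \<Longrightarrow> A $ i = B $ i"
    and "n \<le> N"
  shows "D $ n = E $ n"
  using \<open>n \<le> N\<close>
proof (induction n rule: less_induct)
  case (less n)
  show ?case
  proof (cases n)
    case 0
    then show ?thesis using assms by simp
  next
    case (Suc m)
    have rec: "of_nat (Suc m) * F $ Suc m =
        z * (\<Sum>i\<le>m. of_nat (Suc i) * C $ Suc i * F $ (m - i)) -
          (\<Sum>i<m. of_nat (Suc i) * F $ Suc i * C $ (m - i))"
      if "is_fps_power z C F" "C $ 0 = 1" for C F
    proof -
      have "(fps_deriv F * C) $ m = z * (fps_deriv C * F) $ m"
        using that by (simp add: is_fps_power_def mult.assoc)
      moreover have "{..m} = insert m {..<m}" by auto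
      ultimately show ?thesis
        using that(2) by (simp add: fps_mult_nth atLeast0AtMost mult.assoc sum_distrib_left add.commute diff_eq_eq eq_diff_eq del: of_nat_Suc)
    qed
    have "of_nat (Suc m) * D $ Suc m = of_nat (Suc m) * E $ Suc m"
      unfolding rec[OF D 0(1)] rec[OF E, unfolded eq[of 0, symmetric, simplified] , OF 0(1)]
      using less Suc eq by (intro arg_cong2[where f="(-)"] arg_cong2[where f="(*)"] sum.cong) auto
    then show ?thesis by (simp add: Suc del: of_nat_Suc)
  qed
qed

definition correction_series :: "complex \<Rightarrow> complex fps" where
  "correction_series z = binomial_series z * local_series z"

definition euler_correction :: "complex \<Rightarrow> 'a::field poly set \<Rightarrow> complex fps" where
  "euler_correction z P = (\<Prod>\<pi>\<in>P. correction_series z oo fps_X ^ degree \<pi>)"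

text \<open>The convolution of the correction with (1 - qT)^(-z). At z = 1 the truncated Euler
  product merely counts monic polynomials, so up to degree d it agrees with 1/(1 - qT). The product
  D of the local powers (1 - X)^(-z) is the z-th power of that Euler product, and hence agrees with
  (1 - qT)^(-z) up to degree d.\<close>

lemma sum_power_omega_eq:
  fixes z :: complex
  defines "q \<equiv> CARD('a::{field,finite})"
  shows "(\<Sum>f\<in>(monic_of_degree d :: 'a poly set). z ^ omega f) =
    (\<Sum>m\<le>d. euler_correction z (irreducibles_upto d :: 'a poly set) $ m *
        (of_nat q ^ (d - m) * (pochhammer z (d - m) / fact (d - m))))"
proof -
  define P where "P = (irreducibles_upto d :: 'a poly set)"
  have P: "finite P" "P \<subseteq> monic_irreducibles" by (auto simp: P_def irreducibles_upto_subset)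
  have X0: "(fps_X ^ degree \<pi> :: complex fps) $ 0 = 0" if "\<pi> \<in> P" for \<pi>
    using that monic_irreducible_degree_pos P by auto
  define D where "D = (\<Prod>\<pi>\<in>P. binomial_series (-z) oo fps_X ^ degree \<pi>)"
  have loc: "local_series z = correction_series z * binomial_series (-z)"
    using binomial_series_mult_uminus[of z] unfolding correction_series_def
    by (metis mult.assoc mult.commute mult_1)
  have "omega_series z P = euler_correction z P * D"
    unfolding omega_series_eq_prod[OF P] euler_correction_def D_def prod.distrib[symmetric]
    by (intro prod.cong) (simp_all only: loc fps_compose_mult_distrib[OF X0])
  moreover have "D $ n = of_nat q ^ n * (pochhammer z n / fact n)" if "n \<le> d" for n
  proof -
    define E where "E = binomial_series (-z) oo (fps_const (of_nat q) * fps_X)"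
    have "is_fps_power z (omega_series 1 P) D"
      unfolding omega_series_eq_prod[OF P] D_def
      by (intro is_fps_power_prod is_fps_power_compose is_fps_power_binomial_series X0)
    moreover have "is_fps_power z (local_series 1 oo (fps_const (of_nat q) * fps_X)) E"
      unfolding E_def by (intro is_fps_power_compose is_fps_power_binomial_series) auto
    moreover have "omega_series 1 P $ 0 = 1"
      unfolding P_def by (simp add: omega_series_irreducibles_upto_nth monic_of_degree_0)
    moreover have "D $ 0 = E $ 0"
      by (simp add: D_def E_def fps_prod_nth_zero binomial_series_nth)
    moreover have "omega_series 1 P $ i = (local_series 1 oo (fps_const (of_nat q) * fps_X)) $ i"
      if "i \<le> d" for i
      unfolding fps_nth_compose_linear P_def omega_series_irreducibles_upto_nth[OF that]
      by (simp add: card_monic_of_degree local_series_def q_def)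
    ultimately have "D $ n = E $ n" using that by (rule is_fps_power_nth_eq[where N = d])
    then show ?thesis by (simp only: E_def fps_nth_compose_linear binomial_series_nth_uminus)
  qed
  ultimately have "omega_series z P $ d = (\<Sum>m\<le>d. euler_correction z P $ m *
        (of_nat q ^ (d - m) * (pochhammer z (d - m) / fact (d - m))))"
    by (simp add: fps_mult_nth atLeast0AtMost)
  then show ?thesis by (simp add: P_def omega_series_irreducibles_upto_nth)
qed

subsection \<open>Asymptotics of the binomial coefficients\<close>

text \<open>The first-order terms cancel: the function is 1 at 0 and has derivative z (1 - z) w (1 +
  w)^(-z-1). On the segment from 0 to t this is at most 2t in norm, since |1 - z| \<le> 2 and Re z
  \<ge> -1 makes the last factor at most 1. The quadratic order makes the bounds summable over t =
  1/n.\<close>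

lemma norm_binomial_ratio_minus_1_le:
  fixes z :: complex and t :: real
  assumes z: "norm z = 1" and t: "t \<ge> 0"
  shows "norm ((1 + z * of_real t) * (1 + of_real t) powr (-z) - 1) \<le> 2 * t\<^sup>2"
proof -
  define S where "S = complex_of_real ` {0..t}"
  define f where "f = (\<lambda>w. (1 + z * w) * (1 + w) powr (-z))"
  define f' where "f' = (\<lambda>w. z * (1 - z) * w * (1 + w) powr (-z-1))"
  have S: "S = closed_segment 0 (complex_of_real t)"
    using t by (simp add: S_def closed_segment_of_real[of 0 t, simplified] closed_segment_eq_real_ivl)
  have "norm (f (of_real t) - f 0) \<le> (2 * t) * norm (complex_of_real t - 0)"
  proof (rule field_differentiable_bound[of S])
    show "convex S" by (simp add: S)
    show "of_real t \<in> S" "0 \<in> S" using t by (auto simp: S_def)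
  next
    fix w assume w: "w \<in> S"
    then obtain x where x: "w = of_real x" "0 \<le> x" "x \<le> t" by (auto simp: S_def)
    have nn: "1 + w \<notin> \<real>\<^sub>\<le>\<^sub>0" using x by (metis add_pos_nonneg complex_nonpos_Reals_iff Re_complex_of_real not_le of_real_1 of_real_add zero_less_one)
    then have nz: "1 + w \<noteq> 0" by auto
    have powr: "(1 + w) powr (-z) = (1 + w) * (1 + w) powr (-z-1)"
      using nz by (metis add.commute diff_add_cancel powr_add powr_one_gt_zero_iff powr_to_1 mult.commute)
    have "(f has_field_derivative
        (z * (1 + w) powr (-z) + (1 + z * w) * (- z * (1 + w) powr (-z-1)))) (at w within S)"
      unfolding f_def using nn by (auto intro!: derivative_eq_intros simp: algebra_simps)
    also have "z * (1 + w) powr (-z) + (1 + z * w) * (- z * (1 + w) powr (-z-1)) = f' w"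
      by (simp add: powr f'_def algebra_simps)
    finally show "(f has_field_derivative f' w) (at w within S)" .
    have "\<bar>Re z\<bar> \<le> 1" using z abs_Re_le_cmod by metis
    have "norm ((1 + w) powr (-z-1)) = (1 + x) powr (- Re z - 1)"
      using x by (simp add: norm_powr_real_powr)
    also have "\<dots> \<le> (1 + x) powr 0"
      using x \<open>\<bar>Re z\<bar> \<le> 1\<close> by (intro powr_mono) auto
    finally have 1: "norm ((1 + w) powr (-z-1)) \<le> 1" using x by simp
    have 2: "norm (1 - z) \<le> 2" using norm_triangle_ineq4[of 1 z] z by simp
    have "norm (f' w) = norm (1 - z) * x * norm ((1 + w) powr (-z-1))"
      using z x by (simp add: f'_def norm_mult)
    also have "\<dots> \<le> 2 * t * 1" using 1 2 x by (intro mult_mono) auto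
    finally show "norm (f' w) \<le> 2 * t" by simp
  qed
  then show ?thesis using t by (simp add: f_def power2_eq_square)
qed

text \<open>For \<open>n > 0\<close>, this is \<open>n\<^bsup>1-z\<^esup> / z\<close> times the \<open>n\<close>-th coefficient of \<open>(1 - X)\<^bsup>-z\<^esup>\<close>.\<close>

definition scaled_coeff :: "complex \<Rightarrow> nat \<Rightarrow> complex" where
  "scaled_coeff z n = exp ((1 - z) * of_real (ln (real n))) * (pochhammer (z + 1) (n - 1) / fact n)"

text \<open>With t = 1/n, the power of n changes by (1 + t)^(1-z) and the Pochhammer quotient by (z
  + n)/(n + 1) = (1 + z t)/(1 + t); one factor 1 + t cancels.\<close>

lemma scaled_coeff_Suc:
  assumes "n > 0"
  shows "scaled_coeff z (Suc n) =
    scaled_coeff z n * ((1 + z * of_real (1 / real n)) * (1 + of_real (1 / real n)) powr (-z))"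
proof -
  define t where "t = 1 / real n"
  have t: "t > 0" "1 + t \<noteq> 0" using assms by (auto simp: t_def add_nonneg_eq_0_iff)
  have Suc: "real (Suc n) = (1 + t) * real n" using assms by (simp add: t_def field_simps)
  have ln: "ln (real (Suc n)) = ln (1 + t) + ln (real n)"
    unfolding Suc using t assms by (subst ln_mult) auto
  have "Ln (1 + of_real t) = of_real (ln (1 + t))"
    using Ln_of_real[of "1 + t"] t by simp
  moreover have "1 + complex_of_real t \<noteq> 0"
    using t(2) by (metis of_real_1 of_real_add of_real_eq_0_iff)
  ultimately have powr: "(1 + of_real t) powr w = exp (w * of_real (ln (1 + t)))" for w :: complex
    by (simp add: powr_def)
  have 1: "exp ((1 - z) * of_real (ln (real (Suc n)))) =
      exp ((1 - z) * of_real (ln (real n))) * ((1 + of_real t) * (1 + of_real t) powr (-z))"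
  proof -
    have "(1 + of_real t :: complex) = of_real (exp (ln (1 + t)))" using t by simp
    also have "\<dots> = exp (of_real (ln (1 + t)))" by (rule exp_of_real[symmetric])
    finally show ?thesis
      unfolding powr ln by (simp add: exp_add[symmetric] algebra_simps)
  qed
  obtain m where m: "n = Suc m" using assms by (cases n) auto
  have 2: "pochhammer (z + 1) n = pochhammer (z + 1) (n - 1) * (z + of_nat n)"
    unfolding m by (simp add: pochhammer_rec' add_ac mult.commute)
  have 3: "(z + of_nat n) * (1 + of_real t) = of_nat (Suc n) * (1 + z * of_real t)"
    using assms by (simp add: t_def field_simps)
  have "scaled_coeff z (Suc n) = exp ((1 - z) * of_real (ln (real n))) * (pochhammer (z + 1) (n - 1) / fact n)
      * ((1 + of_real t) powr (-z) * ((z + of_nat n) * (1 + of_real t) / of_nat (Suc n)))"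
    unfolding scaled_coeff_def 1 by (simp add: 2 divide_simps del: of_nat_Suc)
  then show ?thesis unfolding 3 by (simp add: scaled_coeff_def t_def mult_ac del: of_nat_Suc)
qed

lemma summable_inverse_Suc_squared: "summable (\<lambda>n. 2 * (1 / real (Suc n))\<^sup>2)"
proof -
  have "summable (\<lambda>n. inverse (real n ^ 2))"
    using inverse_power_summable[of 2, where ?'a = real] by simp
  then have "summable (\<lambda>n. inverse (real (Suc n) ^ 2))"
    by (subst summable_Suc_iff)
  then show ?thesis
    by (intro summable_mult) (simp add: inverse_eq_divide power_divide del: of_nat_Suc)
qed

text \<open>It dominates every finite product of factors 1 + 2/k^2, because 1 + x \<le> exp x. The
  start is \<open>scaled_coeff z 1 = 1\<close>, so it bounds all scaled coefficients on the unit
  circle, independently of z.\<close>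

definition scaled_coeff_bound :: real where
  "scaled_coeff_bound = exp (\<Sum>n. 2 * (1 / real (Suc n))\<^sup>2)"

lemma scaled_coeff_step:
  assumes "norm z = 1"
  shows "norm (scaled_coeff z (Suc (Suc n)) - scaled_coeff z (Suc n))
    \<le> norm (scaled_coeff z (Suc n)) * (2 * (1 / real (Suc n))\<^sup>2)"
proof -
  define r where "r = (1 + z * of_real (1 / real (Suc n))) * (1 + of_real (1 / real (Suc n))) powr (-z)"
  have "scaled_coeff z (Suc (Suc n)) - scaled_coeff z (Suc n) = scaled_coeff z (Suc n) * (r - 1)"
    unfolding scaled_coeff_Suc[OF zero_less_Suc] r_def by (simp add: algebra_simps)
  moreover have "norm (r - 1) \<le> 2 * (1 / real (Suc n))\<^sup>2"
    unfolding r_def using assms by (intro norm_binomial_ratio_minus_1_le) auto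
  ultimately show ?thesis by (simp only: norm_mult) (intro mult_left_mono; simp)
qed

lemma norm_scaled_coeff_le:
  assumes "norm z = 1" "n > 0"
  shows "norm (scaled_coeff z n) \<le> scaled_coeff_bound"
proof -
  define a where "a = (\<lambda>n. 2 * (1 / real (Suc n))\<^sup>2)"
  have "norm (scaled_coeff z (Suc n)) \<le> exp (\<Sum>k<n. a k)" for n
  proof (induction n)
    case 0
    then show ?case by (simp add: scaled_coeff_def)
  next
    case (Suc n)
    have "norm (scaled_coeff z (Suc (Suc n))) \<le>
        norm (scaled_coeff z (Suc n)) + norm (scaled_coeff z (Suc (Suc n)) - scaled_coeff z (Suc n))"
      by norm
    also have "\<dots> \<le> norm (scaled_coeff z (Suc n)) * (1 + a n)"
      using scaled_coeff_step[OF assms(1), of n] by (simp add: a_def algebra_simps)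
    also have "\<dots> \<le> exp (\<Sum>k<n. a k) * exp (a n)"
      by (intro mult_mono Suc.IH exp_ge_add_one_self) (auto simp: a_def)
    finally show ?case by (simp add: exp_add)
  qed
  also have "exp (\<Sum>k<n. a k) \<le> scaled_coeff_bound" for n
    unfolding scaled_coeff_bound_def a_def[symmetric] exp_le_cancel_iff
    using summable_inverse_Suc_squared by (intro sum_le_suminf) (auto simp: a_def)
  finally have "norm (scaled_coeff z (Suc n)) \<le> scaled_coeff_bound" for n .
  then show ?thesis using assms(2) by (cases n) auto
qed

text \<open>Gauss's product for 1/\<Gamma>(z+1), up to two factors:
  \<open>rGamma_series (z + 1) n\<close> contains z + n and z + 1 + n in addition, and each of them
  divided by n tends to 1.\<close>

lemma scaled_coeff_LIMSEQ: "scaled_coeff z \<longlonglongrightarrow> rGamma (z + 1)"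
proof -
  have inv: "(\<lambda>n. w / of_nat n) \<longlonglongrightarrow> 0" for w :: complex
    by (intro tendsto_divide_0[OF tendsto_const] tendsto_of_nat)
  have "(\<lambda>n. rGamma_series (z + 1) n * (inverse (1 + z / of_nat n) * inverse (1 + (z + 1) / of_nat n)))
      \<longlonglongrightarrow> rGamma (z + 1) * (inverse (1 + 0) * inverse (1 + 0))"
    by (intro tendsto_intros inv rGamma_series_LIMSEQ) auto
  moreover have "\<forall>\<^sub>F n in sequentially. rGamma_series (z + 1) n * (inverse (1 + z / of_nat n) * inverse (1 + (z + 1) / of_nat n))
    = scaled_coeff z n"
    \<comment> \<open>From here on n > |z| + 1, so neither z + n nor z + 1 + n vanishes and both can
      be inverted.\<close>
    using eventually_gt_at_top[of "nat \<lceil>norm z\<rceil> + 1"]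
  proof eventually_elim
    case (elim n)
    have n: "real n > norm z + 1" "n > 0" using elim by linarith+
    have nz: "z + of_nat n \<noteq> 0" "z + 1 + of_nat n \<noteq> 0"
    proof -
      have "norm (of_nat n :: complex) > norm (-z)" using n by simp
      then show "z + of_nat n \<noteq> 0" by (metis add.inverse_unique less_irrefl)
      have "norm (of_nat n :: complex) > norm (-(z+1))"
        using n norm_triangle_ineq[of z 1] by (simp only: norm_minus_cancel norm_of_nat norm_one)
      then show "z + 1 + of_nat n \<noteq> 0" by (metis add.inverse_unique less_irrefl)
    qed
    obtain m where m: "n = Suc m" using n by (cases n) auto
    have "pochhammer (z + 1) (n + 1) = pochhammer (z + 1) (n - 1) * (z + of_nat n) * (z + 1 + of_nat n)"
      unfolding m by (simp add: pochhammer_rec' algebra_simps)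
    moreover have "exp ((1 - z) * of_real (ln (real n))) * exp ((z + 1) * of_real (ln (real n))) = of_nat n * of_nat n"
    proof -
      have "exp ((1 - z) * of_real (ln (real n))) * exp ((z + 1) * of_real (ln (real n))) =
          exp (of_real (ln (real n))) * exp (of_real (ln (real n)))"
        by (simp add: algebra_simps flip: exp_add)
      also have "exp (of_real (ln (real n))) = complex_of_real (exp (ln (real n)))" by (rule exp_of_real)
      finally show ?thesis using n by simp
    qed
    moreover have "exp ((z + 1) * of_real (ln (real n))) \<noteq> 0" by simp
    moreover have "inverse (1 + z / of_nat n) = of_nat n / (z + of_nat n)"
        "inverse (1 + (z + 1) / of_nat n) = of_nat n / (z + 1 + of_nat n)"
      using n by (auto simp: field_simps)
    moreover have "P * a * b / (F * E) * ((N / a) * (N / b)) = D * (P / F)"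
      if "D * E = N * N" "E \<noteq> 0" "a \<noteq> 0" "b \<noteq> 0" for P a b F E D N :: complex
    proof -
      have "D = N * N / E" using that by (simp add: eq_divide_eq)
      then show ?thesis using that(2-4) by (simp add: divide_simps)
    qed
    ultimately show ?case using nz unfolding rGamma_series_def scaled_coeff_def by simp
  qed
  ultimately show ?thesis by (simp add: filterlim_cong)
qed

text \<open>Gauss's product gives only pointwise convergence. Uniformity comes from the telescoping
  series of consecutive differences, dominated by a multiple of \<Sum> 1/n^2 that does not involve
  z; uniqueness of limits then identifies its sum.\<close>

lemma scaled_coeff_uniform_limit:
  "uniform_limit {z. norm z = 1} (\<lambda>n z. scaled_coeff z n) (\<lambda>z. rGamma (z + 1)) sequentially"
proof -
  \<comment> \<open>Shifted by one because the ratio formula and the bound start at index 1.\<close>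
  define g where "g = (\<lambda>n z. scaled_coeff z (Suc n))"
  define C where "C = scaled_coeff_bound"
  have "uniform_limit {z. norm z = 1} (\<lambda>n z. \<Sum>k<n. g (Suc k) z - g k z)
      (\<lambda>z. \<Sum>k. g (Suc k) z - g k z) sequentially"
  proof (rule Weierstrass_m_test)
    show "summable (\<lambda>n. C * (2 * (1 / real (Suc n))\<^sup>2))"
      by (intro summable_mult summable_inverse_Suc_squared)
    show "norm (g (Suc n) z - g n z) \<le> C * (2 * (1 / real (Suc n))\<^sup>2)" if "z \<in> {z. norm z = 1}" for n z
    proof -
      have z: "norm z = 1" using that by simp
      have "norm (g (Suc n) z - g n z) \<le> norm (g n z) * (2 * (1 / real (Suc n))\<^sup>2)"
        unfolding g_def using scaled_coeff_step[OF z] .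
      also have "\<dots> \<le> C * (2 * (1 / real (Suc n))\<^sup>2)"
        unfolding g_def C_def by (intro mult_right_mono norm_scaled_coeff_le z) auto
      finally show ?thesis .
    qed
  qed
  then have "uniform_limit {z. norm z = 1} (\<lambda>n z. g 0 z + (\<Sum>k<n. g (Suc k) z - g k z))
      (\<lambda>z. g 0 z + (\<Sum>k. g (Suc k) z - g k z)) sequentially"
    by (intro uniform_limit_add uniform_limit_const)
  then have u: "uniform_limit {z. norm z = 1} g (\<lambda>z. g 0 z + (\<Sum>k. g (Suc k) z - g k z)) sequentially"
    by (subst (asm) sum_lessThan_telescope) simp
  moreover have "g 0 z + (\<Sum>k. g (Suc k) z - g k z) = rGamma (z + 1)" if "norm z = 1" for z
  proof -
    have "(\<lambda>n. g n z) \<longlonglongrightarrow> rGamma (z + 1)"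
      unfolding g_def using scaled_coeff_LIMSEQ LIMSEQ_Suc by blast
    then show ?thesis using tendsto_uniform_limitI[OF u, of z] that LIMSEQ_unique by auto
  qed
  ultimately have "uniform_limit {z. norm z = 1} g (\<lambda>z. rGamma (z + 1)) sequentially"
    by (subst (asm) uniform_limit_cong'[where g = g]) auto
  then have "uniform_limit {z. norm z = 1} (\<lambda>n. g (n - 1)) (\<lambda>z. rGamma (z + 1)) sequentially"
    by (rule filterlim_compose) (rule filterlim_minus_const_nat_at_top)
  moreover have "\<forall>\<^sub>F n in sequentially. \<forall>z\<in>{z. norm z = 1}. g (n - 1) z = scaled_coeff z n"
    using eventually_gt_at_top[of 0] by eventually_elim (simp add: g_def)
  ultimately show ?thesis by (subst (asm) uniform_limit_cong) auto
qed

lemma norm_rGamma_le_scaled_coeff_bound: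
  fixes z :: complex
  assumes "norm z = 1"
  shows "norm (rGamma (z + 1)) \<le> scaled_coeff_bound"
proof (rule tendsto_upperbound)
  show "(\<lambda>n. norm (scaled_coeff z n)) \<longlonglongrightarrow> norm (rGamma (z + 1))"
    by (intro tendsto_norm scaled_coeff_LIMSEQ)
  show "\<forall>\<^sub>F n in sequentially. norm (scaled_coeff z n) \<le> scaled_coeff_bound"
    using eventually_gt_at_top[of 0] by eventually_elim (auto intro: norm_scaled_coeff_le assms)
qed auto

section \<open>Coefficients of index d - m under the normalisation of degree d\<close>

lemma norm_exp_minus_1_le: "norm (exp w - 1) \<le> exp (norm w) * norm w" for w :: complex
proof -
  have "norm (exp w - exp 0) \<le> exp (norm w) * norm (w - 0)"
  proof (rule field_differentiable_bound[of "cball 0 (norm w)"])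
    show "norm (exp x) \<le> exp (norm w)" if "x \<in> cball 0 (norm w)" for x :: complex
      using that norm_exp[of x] by (auto intro: order_trans)
  qed (auto intro!: derivative_eq_intros)
  then show ?thesis by simp
qed

text \<open>What the convolution meets: the coefficient of index d - m of (1 - X)^(-z), scaled by
  d^(1-z) rather than (d-m)^(1-z). The division by z comes from the exponent
  \<open>omega f - 1\<close>.\<close>

definition shifted_coeff :: "complex \<Rightarrow> nat \<Rightarrow> nat \<Rightarrow> complex" where
  "shifted_coeff z d m = exp ((1 - z) * of_real (ln (real d))) * (pochhammer z (d - m) / fact (d - m)) / z"

lemma shifted_coeff_eq:
  assumes "n > 0" "norm z = 1"
  shows "shifted_coeff z (n + m) m =
    scaled_coeff z n * exp ((1 - z) * of_real (ln (1 + real m / real n)))"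
proof -
  have "real (n + m) = real n * (1 + real m / real n)" using assms by (simp add: field_simps)
  moreover have "1 + real m / real n > 0" using assms by (auto intro: add_pos_nonneg)
  ultimately have "ln (real (n + m)) = ln (real n) + ln (1 + real m / real n)"
    using assms by (simp only: ln_mult_pos of_nat_0_less_iff)
  moreover obtain k where "n = Suc k" using assms by (cases n) auto
  moreover have "z \<noteq> 0" using assms by auto
  ultimately show ?thesis
    by (simp add: shifted_coeff_def scaled_coeff_def pochhammer_rec ring_distribs exp_add del: of_nat_Suc of_nat_add)
qed

lemma norm_1_minus_le_2: "norm z = 1 \<Longrightarrow> norm (1 - z) \<le> 2" for z :: complex
  using norm_triangle_ineq4[of 1 z] by simp

lemma norm_exp_ln_le:
  assumes "norm z = 1" "x \<ge> 1"
  shows "norm (exp ((1 - z) * complex_of_real (ln x))) \<le> x\<^sup>2"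
proof -
  have "Re (1 - z) \<le> 2" using norm_1_minus_le_2[OF assms(1)] complex_Re_le_cmod order_trans by blast
  then have "Re (1 - z) * ln x \<le> 2 * ln x" using assms by (intro mult_right_mono) auto
  then have "norm (exp ((1 - z) * complex_of_real (ln x))) \<le> exp (2 * ln x)" by simp
  also have "\<dots> = x\<^sup>2" using assms by (simp add: exp_double)
  finally show ?thesis .
qed

lemma scaled_coeff_bound_ge_1: "scaled_coeff_bound \<ge> 1"
  using norm_scaled_coeff_le[of 1 1] by (simp add: scaled_coeff_def)

text \<open>Changing the normalisation from n = d - m to d costs |(1 + m/n)^(1-z)| \<le> (1 + m)^2,
  as n \<ge> 1. The case m = d stands apart: there n = 0 and the quantity is d^(1-z)/z. The bound is
  polynomial in m and free of d, which a geometric weight can absorb.\<close>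

lemma norm_shifted_coeff_le:
  assumes "norm z = 1" "m \<le> d" "d > 0"
  shows "norm (shifted_coeff z d m) \<le> scaled_coeff_bound * (real m + 1)\<^sup>2"
proof (cases "m = d")
  case True
  have "norm (shifted_coeff z d m) = norm (exp ((1 - z) * of_real (ln (real d))))"
    by (simp add: True shifted_coeff_def norm_mult norm_divide assms(1) del: norm_exp_eq_Re)
  also have "\<dots> \<le> (real d)\<^sup>2" using assms by (intro norm_exp_ln_le) auto
  also have "\<dots> \<le> 1 * (real m + 1)\<^sup>2" by (simp add: True power2_eq_square algebra_simps)
  also have "\<dots> \<le> scaled_coeff_bound * (real m + 1)\<^sup>2"
    by (intro mult_right_mono scaled_coeff_bound_ge_1) auto
  finally show ?thesis .
next
  case False
  define n where "n = d - m"
  have n: "n > 0" "d = n + m" using False assms by (auto simp: n_def)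
  have "real m / real n \<le> real m / 1" using n by (intro divide_left_mono) auto
  then have "1 + real m / real n \<le> real m + 1" by simp
  then have "(1 + real m / real n)\<^sup>2 \<le> (real m + 1)\<^sup>2" by (intro power_mono) auto
  then have "norm (exp ((1 - z) * of_real (ln (1 + real m / real n)))) \<le> (real m + 1)\<^sup>2"
    by (intro order_trans[OF norm_exp_ln_le[OF assms(1)]]) auto
  then have "norm (scaled_coeff z n) * norm (exp ((1 - z) * of_real (ln (1 + real m / real n)))) \<le>
      scaled_coeff_bound * (real m + 1)\<^sup>2"
    using n assms scaled_coeff_bound_ge_1 by (intro mult_mono norm_scaled_coeff_le) auto
  then show ?thesis unfolding n shifted_coeff_eq[OF n(1) assms(1)] by (simp only: norm_mult)
qed

lemma shifted_coeff_uniform_limit: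
  "uniform_limit {z. norm z = 1} (\<lambda>n z. shifted_coeff z (n + m) m) (\<lambda>z. rGamma (z + 1)) sequentially"
proof (rule uniform_limitI)
  fix e :: real assume "e > 0"
  define C where "C = scaled_coeff_bound"
  \<comment> \<open>Bounds |w| below, by |1 - z| \<le> 2 and ln (1 + x) \<le> x. For fixed m it
    tends to 0, so the change of normalisation is harmless in the limit.\<close>
  define b where "b = (\<lambda>n. 2 * (real m / real n))"
  have b: "b \<longlonglongrightarrow> 0" unfolding b_def by (intro tendsto_mult_right_zero lim_const_over_n)
  have "(\<lambda>n. C * (exp (b n) * b n)) \<longlonglongrightarrow> C * (exp 0 * 0)" by (intro tendsto_intros b)
  then have "\<forall>\<^sub>F n in sequentially. C * (exp (b n) * b n) < e / 2"
    by (rule order_tendstoD) (use \<open>e > 0\<close> in simp)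
  moreover have "\<forall>\<^sub>F n in sequentially. \<forall>z\<in>{z. norm z = 1}. dist (scaled_coeff z n) (rGamma (z + 1)) < e / 2"
    using scaled_coeff_uniform_limit half_gt_zero[OF \<open>e > 0\<close>] unfolding uniform_limit_iff by blast
  ultimately show "\<forall>\<^sub>F n in sequentially. \<forall>z\<in>{z. norm z = 1}. dist (shifted_coeff z (n + m) m) (rGamma (z + 1)) < e"
    using eventually_gt_at_top[of 0]
  proof eventually_elim
    case (elim n)
    show ?case
    proof
      fix z :: complex assume "z \<in> {z. norm z = 1}"
      then have z: "norm z = 1" by simp
      define w where "w = (1 - z) * complex_of_real (ln (1 + real m / real n))"
      have "norm w = norm (1 - z) * ln (1 + real m / real n)"
        unfolding w_def by (simp add: norm_mult)
      also have "\<dots> \<le> b n"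
        unfolding b_def using norm_1_minus_le_2[OF z]
        by (intro mult_mono ln_add_one_self_le_self) auto
      finally have w: "norm w \<le> b n" .
      have "norm (scaled_coeff z n * (exp w - 1)) \<le> C * (exp (norm w) * norm w)"
        unfolding norm_mult C_def using elim z
        by (intro mult_mono norm_scaled_coeff_le norm_exp_minus_1_le order_trans[OF _ scaled_coeff_bound_ge_1]) auto
      also have "\<dots> \<le> C * (exp (b n) * b n)"
        using w scaled_coeff_bound_ge_1 by (intro mult_left_mono mult_mono) (auto simp: C_def)
      also have "\<dots> < e / 2" using elim by simp
      finally have "norm (scaled_coeff z n * (exp w - 1)) < e / 2" .
      moreover have "norm (scaled_coeff z n - rGamma (z + 1)) < e / 2"
        using elim z by (auto simp: dist_norm)
      moreover have "shifted_coeff z (n + m) m - rGamma (z + 1) =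
          scaled_coeff z n * (exp w - 1) + (scaled_coeff z n - rGamma (z + 1))"
        unfolding shifted_coeff_eq[OF elim(3) z] w_def by (simp add: algebra_simps)
      ultimately show "dist (shifted_coeff z (n + m) m) (rGamma (z + 1)) < e"
        unfolding dist_norm by (smt (verit) norm_triangle_ineq field_sum_of_halves)
    qed
  qed
qed

text \<open>Without the weight, convergence is not uniform in m \<le> d: at m = d the coefficient is
  d^(1-z)/z. From some M on, the weight beats the quadratic bounds of both terms; below M there are
  finitely many uniform limits.\<close>

lemma weighted_shifted_coeff_limit:
  fixes \<rho> e :: real
  assumes \<rho>: "0 < \<rho>" "\<rho> < 1" and e: "e > 0"
  shows "\<forall>\<^sub>F d in sequentially. \<forall>z m. norm z = 1 \<longrightarrow> m \<le> d \<longrightarrow>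
     \<rho> ^ m * norm (shifted_coeff z d m - rGamma (z + 1)) < e"
proof -
  define C where "C = scaled_coeff_bound"
  have C: "C \<ge> 1" using scaled_coeff_bound_ge_1 by (simp add: C_def)
  have "(\<lambda>m. 2 * C * (\<rho> ^ m * (real m + 1)\<^sup>2)) \<longlonglongrightarrow> 0"
  proof -
    \<comment> \<open>The root turns \<rho>^m (m+1)^2 into the square of m x^m + x^m, whose two
      terms tend to 0.\<close>
    define x where "x = sqrt \<rho>"
    have x: "norm x < 1" using \<rho> by (simp add: x_def)
    have "(\<lambda>m. 2 * C * (real m * x ^ m + x ^ m)\<^sup>2) \<longlonglongrightarrow> 2 * C * (0 + 0)\<^sup>2"
      by (intro tendsto_intros powser_times_n_limit_0 LIMSEQ_power_zero x)
    moreover have "(real m * x ^ m + x ^ m)\<^sup>2 = \<rho> ^ m * (real m + 1)\<^sup>2" for m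
    proof -
      have "\<rho> = x\<^sup>2" using \<rho> by (simp add: x_def)
      then show ?thesis by (simp add: power_mult[symmetric] power2_eq_square power_mult_distrib algebra_simps)
    qed
    ultimately show ?thesis by simp
  qed
  then have "\<forall>\<^sub>F m in sequentially. 2 * C * (\<rho> ^ m * (real m + 1)\<^sup>2) < e"
    using e by (intro order_tendstoD) auto
  then obtain M where M: "\<And>m. m \<ge> M \<Longrightarrow> 2 * C * (\<rho> ^ m * (real m + 1)\<^sup>2) < e"
    by (auto simp: eventually_at_top_linorder)
  have "\<forall>\<^sub>F d in sequentially. \<forall>z\<in>{z. norm z = 1}. dist (shifted_coeff z d m) (rGamma (z + 1)) < e" for m
  proof -
    have "\<forall>\<^sub>F n in sequentially. \<forall>z\<in>{z. norm z = 1}. dist (shifted_coeff z (n + m) m) (rGamma (z + 1)) < e"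
      using shifted_coeff_uniform_limit e by (auto simp: uniform_limit_iff)
    then show ?thesis by (rule eventually_sequentially_seg[THEN iffD1])
  qed
  then have "\<forall>\<^sub>F d in sequentially. \<forall>m\<in>{..<M}. \<forall>z\<in>{z. norm z = 1}. dist (shifted_coeff z d m) (rGamma (z + 1)) < e"
    by (intro eventually_ball_finite) auto
  then show ?thesis using eventually_gt_at_top[of 0]
  proof eventually_elim
    case (elim d)
    show ?case
    proof (intro allI impI)
      fix z :: complex and m assume z: "norm z = 1" and m: "m \<le> d"
      show "\<rho> ^ m * norm (shifted_coeff z d m - rGamma (z + 1)) < e"
      proof (cases "m < M")
        case True
        have "\<rho> ^ m * norm (shifted_coeff z d m - rGamma (z + 1)) \<le> 1 * norm (shifted_coeff z d m - rGamma (z + 1))"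
          using \<rho> by (intro mult_right_mono power_le_one) auto
        also have "\<dots> < e" using elim(1) True z by (auto simp: dist_norm)
        finally show ?thesis .
      next
        case False
        have "norm (shifted_coeff z d m - rGamma (z + 1)) \<le> norm (shifted_coeff z d m) + norm (rGamma (z + 1))"
          by (rule norm_triangle_ineq4)
        also have "\<dots> \<le> C * (real m + 1)\<^sup>2 + C * (real m + 1)\<^sup>2"
        proof (intro add_mono)
          show "norm (shifted_coeff z d m) \<le> C * (real m + 1)\<^sup>2"
            unfolding C_def using elim z m by (intro norm_shifted_coeff_le) auto
          have "norm (rGamma (z + 1)) \<le> C * 1"
            using norm_rGamma_le_scaled_coeff_bound[OF z] by (simp add: C_def)
          also have "\<dots> \<le> C * (real m + 1)\<^sup>2" using C by (intro mult_left_mono one_le_power) auto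
          finally show "norm (rGamma (z + 1)) \<le> C * (real m + 1)\<^sup>2" .
        qed
        finally have "\<rho> ^ m * norm (shifted_coeff z d m - rGamma (z + 1)) \<le> \<rho> ^ m * (2 * C * (real m + 1)\<^sup>2)"
          using \<rho> by (intro mult_left_mono) auto
        also have "\<dots> < e" using M[of m] False by (simp add: mult_ac)
        finally show ?thesis .
      qed
    qed
  qed
qed

subsection \<open>Unordered infinite products\<close>

lemma norm_prod_minus_1_le:
  fixes f :: "'i \<Rightarrow> 'b::real_normed_field"
  assumes "\<And>i. i \<in> F \<Longrightarrow> norm (f i - 1) \<le> M i"
  shows "norm (prod f F - 1) \<le> exp (sum M F) - 1"
  using assms
proof (induction F rule: infinite_finite_induct)
  case (insert i F)
  have M: "M i \<ge> 0" using insert.prems[of i] norm_ge_zero order_trans by blast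
  have i: "norm (f i) \<le> 1 + M i" using insert.prems[of i] norm_triangle_ineq[of "f i - 1" 1] by simp
  have IH: "norm (prod f F - 1) \<le> exp (sum M F) - 1" using insert by auto
  have "norm (prod f (insert i F) - 1) = norm (f i * (prod f F - 1) + (f i - 1))"
    using insert.hyps by (simp add: algebra_simps)
  also have "\<dots> \<le> norm (f i) * norm (prod f F - 1) + norm (f i - 1)"
    by (metis norm_mult norm_triangle_ineq)
  also have "\<dots> \<le> (1 + M i) * (exp (sum M F) - 1) + M i"
    using IH i M insert.prems[of i] by (intro add_mono mult_mono) auto
  also have "\<dots> = (1 + M i) * exp (sum M F) - 1" by (simp add: algebra_simps)
  also have "\<dots> \<le> exp (M i) * exp (sum M F) - 1"
    by (intro diff_right_mono mult_right_mono exp_ge_add_one_self) auto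
  finally show ?case using insert.hyps by (simp add: exp_add)
qed auto

lemma norm_prod_le_exp_sum:
  fixes f :: "'i \<Rightarrow> 'b::real_normed_field"
  assumes "\<And>i. i \<in> F \<Longrightarrow> norm (f i - 1) \<le> M i"
  shows "norm (prod f F) \<le> exp (sum M F)"
  using norm_prod_minus_1_le[OF assms] norm_triangle_ineq[of "prod f F - 1" 1] by force

text \<open>Away from the finitely many factors at distance at least \<open>1/2\<close> from \<open>1\<close>, the product is
  the exponential of an absolutely convergent sum of logarithms.\<close>

lemma tail_prod_tendsto:
  fixes f :: "'i \<Rightarrow> complex"
  assumes f: "\<And>i. i \<in> A \<Longrightarrow> norm (f i - 1) \<le> M i" and M: "M summable_on A"
  obtains F\<^sub>0 P where "finite F\<^sub>0" "F\<^sub>0 \<subseteq> A" "P \<noteq> 0"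
    "((\<lambda>F. \<Prod>i\<in>F. f i) \<longlongrightarrow> P) (finite_subsets_at_top (A - F\<^sub>0))"
proof -
  have M0: "M i \<ge> 0" if "i \<in> A" for i using f[OF that] norm_ge_zero order_trans by blast
  \<comment> \<open>Off this set |f i - 1| < 1/2, the range in which \<open>norm_Ln_le\<close> gives
    |Ln (f i)| \<le> 2 |f i - 1|. The set is finite since each of its members contributes at least
    1/2 to the sum of M.\<close>
  define F0 where "F0 = {i \<in> A. M i \<ge> 1/2}"
  have "finite F0"
  proof (rule ccontr)
    assume "infinite F0"
    obtain N where N: "real N > 2 * infsum M A" using reals_Archimedean2 by blast
    obtain G where G: "finite G" "card G = N" "G \<subseteq> F0"
      using infinite_arbitrarily_large[OF \<open>infinite F0\<close>] by blast
    have "real N * (1/2) \<le> sum M G"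
      using sum_bounded_below[of G "1/2" M] G by (auto simp: F0_def)
    also have "\<dots> \<le> infsum M A"
      using G M0 by (intro finite_sum_le_infsum M) (auto simp: F0_def)
    finally show False using N by simp
  qed
  have small: "norm (f i - 1) < 1/2" if "i \<in> A - F0" for i
    using that f[of i] by (auto simp: F0_def)
  have nz: "f i \<noteq> 0" if "i \<in> A - F0" for i using small[OF that] by auto
  have "(\<lambda>i. norm (Ln (f i))) summable_on (A - F0)"
  proof (rule summable_on_comparison_test)
    show "(\<lambda>i. 2 * M i) summable_on (A - F0)"
      using summable_on_subset_banach[OF M] by (intro summable_on_cmult_right) auto
    show "norm (Ln (f i)) \<le> 2 * M i" if "i \<in> A - F0" for i
      using norm_Ln_le[OF small[OF that]] f[of i] that by auto
  qed auto
  then have "(\<lambda>i. Ln (f i)) summable_on (A - F0)" by (rule abs_summable_summable)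
  then have "((\<lambda>F. \<Sum>i\<in>F. Ln (f i)) \<longlongrightarrow> (\<Sum>\<^sub>\<infinity>i\<in>A - F0. Ln (f i))) (finite_subsets_at_top (A - F0))"
    using has_sum_infsum has_sum_def by blast
  then have "((\<lambda>F. exp (\<Sum>i\<in>F. Ln (f i))) \<longlongrightarrow> exp (\<Sum>\<^sub>\<infinity>i\<in>A - F0. Ln (f i))) (finite_subsets_at_top (A - F0))"
    by (rule tendsto_exp)
  moreover have "\<forall>\<^sub>F F in finite_subsets_at_top (A - F0). exp (\<Sum>i\<in>F. Ln (f i)) = (\<Prod>i\<in>F. f i)"
    using eventually_finite_subsets_at_top_weakI[of "A - F0" "\<lambda>F. exp (\<Sum>i\<in>F. Ln (f i)) = (\<Prod>i\<in>F. f i)"]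
    by (simp add: exp_sum nz subset_iff)
  ultimately have "((\<lambda>F. \<Prod>i\<in>F. f i) \<longlongrightarrow> exp (\<Sum>\<^sub>\<infinity>i\<in>A - F0. Ln (f i))) (finite_subsets_at_top (A - F0))"
    by (rule Lim_transform_eventually)
  then show ?thesis using that \<open>finite F0\<close> by (metis (no_types, lifting) F0_def exp_not_eq_zero mem_Collect_eq subsetI)
qed

lemma uprod_convergent_summable:
  fixes f :: "'i \<Rightarrow> complex"
  assumes "\<And>i. i \<in> A \<Longrightarrow> norm (f i - 1) \<le> M i" "M summable_on A"
  shows "uprod_convergent f A"
  using tail_prod_tendsto[OF assms] unfolding uprod_convergent_def by metis

text \<open>As a \<open>Lim\<close>, \<open>uprod\<close> has content only once a limit is
  exhibited: the nonzero tail limit times the finitely many removed factors. These may vanish, as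
  they do for linear \<pi> when q = 2 and e^(iu) = -1.\<close>

lemma uprod_tendsto:
  fixes f :: "'i \<Rightarrow> complex"
  assumes "\<And>i. i \<in> A \<Longrightarrow> norm (f i - 1) \<le> M i" "M summable_on A"
  shows "((\<lambda>F. \<Prod>i\<in>F. f i) \<longlongrightarrow> uprod f A) (finite_subsets_at_top A)"
proof -
  obtain F0 P where F0: "finite F0" "F0 \<subseteq> A" "((\<lambda>F. \<Prod>i\<in>F. f i) \<longlongrightarrow> P) (finite_subsets_at_top (A - F0))"
    using tail_prod_tendsto[OF assms] by metis
  have "filterlim (\<lambda>F. F - F0) (finite_subsets_at_top (A - F0)) (finite_subsets_at_top A)"
    unfolding filterlim_finite_subsets_at_top eventually_finite_subsets_at_top by blast
  then have "((\<lambda>F. prod f F0 * prod f (F - F0)) \<longlongrightarrow> prod f F0 * P) (finite_subsets_at_top A)"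
    by (intro tendsto_intros filterlim_compose[OF F0(3)])
  moreover have "\<forall>\<^sub>F F in finite_subsets_at_top A. prod f F0 * prod f (F - F0) = prod f F"
    unfolding eventually_finite_subsets_at_top using F0
    by (metis prod.subset_diff mult.commute)
  ultimately have "((\<lambda>F. \<Prod>i\<in>F. f i) \<longlongrightarrow> prod f F0 * P) (finite_subsets_at_top A)"
    by (rule Lim_transform_eventually)
  then show ?thesis unfolding uprod_def by (subst tendsto_Lim) auto
qed

text \<open>For F \<subseteq> G the difference of the products is the product over F times (product
  over G - F, minus 1), at most exp S (exp (S - sum M F) - 1) in norm. This involves neither u nor
  G, so it survives letting G grow to A. Working with products rather than logarithms lets factors
  vanish for some u.\<close>

lemma uprod_uniform_limit:
  fixes f :: "'u \<Rightarrow> 'i \<Rightarrow> complex"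
  assumes f: "\<And>u i. i \<in> A \<Longrightarrow> norm (f u i - 1) \<le> M i" and M: "M summable_on A"
  shows "uniform_limit UNIV (\<lambda>F u. \<Prod>i\<in>F. f u i) (\<lambda>u. uprod (f u) A) (finite_subsets_at_top A)"
proof (rule uniform_limitI)
  fix e :: real assume e: "e > 0"
  define S where "S = infsum M A"
  have M0: "M i \<ge> 0" if "i \<in> A" for i using f[OF that, of undefined] norm_ge_zero order_trans by blast
  have "((\<lambda>F. exp S * (exp (S - sum M F) - 1)) \<longlongrightarrow> exp S * (exp (S - S) - 1)) (finite_subsets_at_top A)"
    using has_sum_infsum[OF M] unfolding has_sum_def S_def by (intro tendsto_intros)
  then have "\<forall>\<^sub>F F in finite_subsets_at_top A. exp S * (exp (S - sum M F) - 1) < e"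
    by (rule order_tendstoD) (use e in simp)
  moreover have "\<forall>\<^sub>F F in finite_subsets_at_top A. finite F \<and> F \<subseteq> A"
    by (rule eventually_finite_subsets_at_top_weakI) auto
  ultimately show "\<forall>\<^sub>F F in finite_subsets_at_top A. \<forall>u\<in>UNIV. dist (\<Prod>i\<in>F. f u i) (uprod (f u) A) < e"
  proof eventually_elim
    case (elim F)
    have sum_le: "sum M G \<le> S" if "finite G" "G \<subseteq> A" for G
      unfolding S_def using that M0 by (intro finite_sum_le_infsum M) auto
    have "norm (prod (f u) G - prod (f u) F) \<le> exp S * (exp (S - sum M F) - 1)"
      if G: "finite G" "F \<subseteq> G" "G \<subseteq> A" for u G
    proof -
      have "prod (f u) G - prod (f u) F = prod (f u) F * (prod (f u) (G - F) - 1)"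
        using G by (simp add: prod.subset_diff[of F G] algebra_simps)
      then have "norm (prod (f u) G - prod (f u) F) = norm (prod (f u) F) * norm (prod (f u) (G - F) - 1)"
        by (simp add: norm_mult)
      also have "\<dots> \<le> exp (sum M F) * (exp (sum M (G - F)) - 1)"
        using elim G f by (intro mult_mono norm_prod_le_exp_sum norm_prod_minus_1_le) (auto simp: subset_iff)
      also have "\<dots> \<le> exp S * (exp (S - sum M F) - 1)"
      proof -
        have "sum M (G - F) = sum M G - sum M F" using G by (simp add: sum_diff)
        moreover have "sum M (G - F) \<ge> 0" using G M0 by (intro sum_nonneg) auto
        ultimately show ?thesis using sum_le[of F] sum_le[of G] G elim by (intro mult_mono) auto
      qed
      finally show ?thesis .
    qed
    then have ev: "\<forall>\<^sub>F G in finite_subsets_at_top A. norm (prod (f u) G - prod (f u) F) \<le> exp S * (exp (S - sum M F) - 1)" for u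
      unfolding eventually_finite_subsets_at_top using elim by blast
    have "norm (uprod (f u) A - prod (f u) F) \<le> exp S * (exp (S - sum M F) - 1)" for u
      by (rule tendsto_upperbound[OF _ ev]) (auto intro!: tendsto_intros uprod_tendsto[OF f M])
    then show ?case using elim by (auto simp: dist_norm norm_minus_commute intro: le_less_trans)
  qed
qed

subsection \<open>Weighted bounds for power series\<close>

text \<open>The weighted l1 norm at radius r is at most B. Stating it by partial sums keeps
  convergence out of the products, under which the bounds multiply.\<close>

definition fps_abs_bound :: "complex fps \<Rightarrow> real \<Rightarrow> real \<Rightarrow> bool" where
  "fps_abs_bound f r B \<longleftrightarrow> (\<forall>n. (\<Sum>m\<le>n. norm (f $ m) * r ^ m) \<le> B)"

lemma fps_abs_bound_1: "fps_abs_bound 1 r 1"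
proof -
  have "(\<Sum>m\<le>n. norm ((1 :: complex fps) $ m) * r ^ m) = (\<Sum>m\<le>n. if m = 0 then 1 else 0)" for n
    by (intro sum.cong) auto
  then show ?thesis by (simp add: fps_abs_bound_def)
qed

lemma fps_abs_bound_mult:
  assumes f: "fps_abs_bound f r B" and g: "fps_abs_bound g r C" and r: "r \<ge> 0"
  shows "fps_abs_bound (f * g) r (B * C)"
  unfolding fps_abs_bound_def
proof
  fix n
  define a where "a = (\<lambda>m. norm (f $ m) * r ^ m)"
  define b where "b = (\<lambda>m. norm (g $ m) * r ^ m)"
  have nonneg: "a m \<ge> 0" "b m \<ge> 0" for m using r by (auto simp: a_def b_def)
  have "norm ((f * g) $ m) * r ^ m \<le> (\<Sum>i\<le>m. a i * b (m - i))" for m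
  proof -
    have "norm ((f * g) $ m) * r ^ m \<le> (\<Sum>i\<le>m. norm (f $ i * g $ (m - i))) * r ^ m"
      unfolding fps_mult_nth atLeast0AtMost using r by (intro mult_right_mono norm_sum) auto
    also have "\<dots> = (\<Sum>i\<le>m. a i * b (m - i))"
      unfolding sum_distrib_right a_def b_def
    proof (intro sum.cong refl)
      fix i assume "i \<in> {..m}"
      then have "r ^ m = r ^ i * r ^ (m - i)" by (simp flip: power_add)
      then show "norm (f $ i * g $ (m - i)) * r ^ m = norm (f $ i) * r ^ i * (norm (g $ (m - i)) * r ^ (m - i))"
        by (simp add: norm_mult mult_ac)
    qed
    finally show ?thesis .
  qed
  then have "(\<Sum>m\<le>n. norm ((f * g) $ m) * r ^ m) \<le> (\<Sum>m\<le>n. \<Sum>i\<le>m. a i * b (m - i))"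
    by (intro sum_mono)
  also have "\<dots> = (\<Sum>(i,j)\<in>{(i,j). i + j \<le> n}. a i * b j)" by (rule sum.triangle_reindex_eq[symmetric])
  also have "\<dots> \<le> (\<Sum>(i,j)\<in>{..n} \<times> {..n}. a i * b j)"
    using nonneg by (intro sum_mono2) auto
  also have "\<dots> = (\<Sum>i\<le>n. a i) * (\<Sum>j\<le>n. b j)"
    by (simp add: sum_product sum.cartesian_product)
  also have "\<dots> \<le> B * C"
  proof -
    have "sum a {..n} \<le> B" "sum b {..n} \<le> C"
      using f g by (auto simp: fps_abs_bound_def a_def b_def)
    moreover have "0 \<le> sum a {..n}" "0 \<le> sum b {..n}" using nonneg by (auto intro: sum_nonneg)
    ultimately show ?thesis by (intro mult_mono) auto
  qed
  finally show "(\<Sum>m\<le>n. norm ((f * g) $ m) * r ^ m) \<le> B * C" .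
qed

lemma fps_abs_bound_prod:
  assumes "\<And>i. i \<in> I \<Longrightarrow> fps_abs_bound (f i) r (B i)" "r \<ge> 0"
  shows "fps_abs_bound (\<Prod>i\<in>I. f i) r (\<Prod>i\<in>I. B i)"
  using assms(1)
  by (induction I rule: infinite_finite_induct)
     (auto intro: fps_abs_bound_1 fps_abs_bound_mult assms(2))

lemma fps_abs_bound_mono: "fps_abs_bound f r B \<Longrightarrow> B \<le> C \<Longrightarrow> fps_abs_bound f r C"
  unfolding fps_abs_bound_def using order_trans by blast

lemma fps_abs_bound_summable:
  assumes "fps_abs_bound f r B" "r \<ge> 0"
  shows "summable (\<lambda>m. norm (f $ m) * r ^ m)" "(\<Sum>m. norm (f $ m) * r ^ m) \<le> B"
proof -
  have b: "(\<Sum>m<n. norm (f $ m) * r ^ m) \<le> B" for n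
  proof -
    have "(\<Sum>m<n. norm (f $ m) * r ^ m) \<le> (\<Sum>m\<le>n. norm (f $ m) * r ^ m)"
      using assms by (intro sum_mono2) auto
    also have "\<dots> \<le> B" using assms by (auto simp: fps_abs_bound_def)
    finally show ?thesis .
  qed
  show s: "summable (\<lambda>m. norm (f $ m) * r ^ m)"
    using assms b by (intro summableI_nonneg_bounded) auto
  show "(\<Sum>m. norm (f $ m) * r ^ m) \<le> B" using s b by (rule suminf_le_const)
qed

lemma fps_abs_bound_conv_radius:
  assumes "fps_abs_bound f r B" "r \<ge> 0"
  shows "fps_conv_radius f \<ge> ereal r"
proof -
  have "summable (\<lambda>m. f $ m * of_real r ^ m)"
    using fps_abs_bound_summable(1)[OF assms] assms(2)
    by (intro summable_norm_cancel[of "\<lambda>m. f $ m * of_real r ^ m"]) (simp add: norm_mult norm_power)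
  from conv_radius_geI[OF this] show ?thesis using assms(2) by (simp add: fps_conv_radius_def)
qed

text \<open>For m \<ge> d the factor (s/r)^m is at most (s/r)^d, and the weighted tail is at most B
  minus the initial sum. That sum is kept on the right because for d = 1 it removes the constant
  term and turns a bound for f into one for f - 1.\<close>

lemma eval_fps_tail_le:
  assumes f: "fps_abs_bound f r B" and s: "0 \<le> s" "s \<le> r" "r > 0"
  shows "norm (eval_fps f (of_real s) - (\<Sum>m<d. f $ m * of_real s ^ m)) \<le>
    (s / r) ^ d * (B - (\<Sum>m<d. norm (f $ m) * r ^ m))"
proof -
  define a where "a = (\<lambda>m. norm (f $ m) * r ^ m)"
  have a: "summable a" "suminf a \<le> B" using fps_abs_bound_summable[OF f] s by (auto simp: a_def)
  have a': "summable (\<lambda>m. a (m + d))" using a(1) by (rule summable_ignore_initial_segment)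
  have le: "norm (f $ (m + d) * of_real s ^ (m + d)) \<le> (s / r) ^ d * a (m + d)" for m
  proof -
    have "norm (f $ (m + d) * of_real s ^ (m + d)) = (s / r) ^ (m + d) * a (m + d)"
      using s by (simp add: a_def norm_mult norm_power power_divide)
    also have "\<dots> \<le> (s / r) ^ d * a (m + d)"
      using s by (intro mult_right_mono power_decreasing) (auto simp: a_def)
    finally show ?thesis .
  qed
  have summ: "summable (\<lambda>m. norm (f $ (m + d) * of_real s ^ (m + d)))"
    using le by (intro summable_comparison_test[OF _ summable_mult[OF a', of "(s / r) ^ d"]]) auto
  then have "summable (\<lambda>m. f $ m * of_real s ^ m)"
    by (subst summable_iff_shift[symmetric, of _ d]) (rule summable_norm_cancel)
  then have "eval_fps f (of_real s) - (\<Sum>m<d. f $ m * of_real s ^ m) = (\<Sum>m. f $ (m + d) * of_real s ^ (m + d))"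
    unfolding eval_fps_def by (subst suminf_split_initial_segment[of _ d]) auto
  also have "norm \<dots> \<le> (\<Sum>m. norm (f $ (m + d) * of_real s ^ (m + d)))"
    using summ by (rule summable_norm)
  also have "\<dots> \<le> (\<Sum>m. (s / r) ^ d * a (m + d))"
    using le summ a' by (intro suminf_le summable_mult) auto
  also have "\<dots> = (s / r) ^ d * (suminf a - (\<Sum>m<d. a m))"
    using a' by (simp add: suminf_mult suminf_minus_initial_segment a(1))
  also have "\<dots> \<le> (s / r) ^ d * (B - (\<Sum>m<d. a m))"
    using a s by (intro mult_left_mono) auto
  finally show ?thesis by (simp add: a_def)
qed

subsection \<open>The correction factor\<close>

lemma norm_binomial_series_nth_le:
  assumes "norm z = 1"
  shows "norm (binomial_series z $ n) \<le> 1"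
proof -
  have "norm (pochhammer (-z) n) \<le> fact n"
  proof (induction n)
    case (Suc n)
    have "norm (-z + of_nat n) \<le> real (Suc n)"
      using norm_triangle_ineq[of "-z" "of_nat n"] assms by simp
    then show ?case
      unfolding pochhammer_rec' norm_mult fact_Suc using Suc
      by (intro mult_mono) auto
  qed auto
  then show ?thesis
    using binomial_series_nth_uminus[of "-z" n] by (simp add: norm_divide divide_le_eq)
qed

lemma norm_local_series_nth: "norm z = 1 \<Longrightarrow> norm (local_series z $ n) = 1"
  by (simp add: local_series_def)

lemma norm_correction_series_nth_le:
  assumes "norm z = 1"
  shows "norm (correction_series z $ n) \<le> real n + 1"
proof -
  have "norm (correction_series z $ n) \<le> (\<Sum>i\<le>n. norm (binomial_series z $ i * local_series z $ (n - i)))"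
    unfolding correction_series_def fps_mult_nth atLeast0AtMost by (rule norm_sum)
  also have "\<dots> \<le> (\<Sum>i\<le>n. 1)"
    using assms by (intro sum_mono) (simp add: norm_mult norm_local_series_nth norm_binomial_series_nth_le)
  finally show ?thesis by simp
qed

lemma correction_series_nth_0: "correction_series z $ 0 = 1"
  by (simp add: correction_series_def binomial_series_nth local_series_def)

lemma correction_series_nth_1: "correction_series z $ Suc 0 = 0"
  by (simp add: correction_series_def binomial_series_nth local_series_def fps_mult_nth_1)

lemma fps_compose_X_power_nth:
  fixes f :: "'b::comm_ring_1 fps"
  assumes "n > 0"
  shows "(f oo fps_X ^ n) $ m = (if n dvd m then f $ (m div n) else 0)"
proof -
  have "(f oo fps_X ^ n) $ m = (\<Sum>i=0..m. if n * i = m then f $ i else 0)"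
    unfolding fps_compose_nth by (intro sum.cong) (auto simp flip: power_mult)
  also have "\<dots> = (if n dvd m then f $ (m div n) else 0)"
  proof (cases "n dvd m")
    case True
    then obtain k where k: "m = n * k" by blast
    have "k \<le> m" using k assms by simp
    have "(\<Sum>i=0..m. if n * i = m then f $ i else 0) = (\<Sum>i=0..m. if i = k then f $ i else 0)"
      using assms k by (intro sum.cong) auto
    then show ?thesis using k assms \<open>k \<le> m\<close> by simp
  next
    case False
    then show ?thesis by (auto intro!: sum.neutral)
  qed
  finally show ?thesis .
qed

text \<open>The value of \<Sum> (j + 3) r^j. Here j + 3 bounds the coefficient of index j + 2 of the
  correction series, left after X^2 is taken out.\<close>

definition correction_const :: "real \<Rightarrow> real" where
  "correction_const r = 1 / (1 - r)\<^sup>2 + 2 * (1 / (1 - r))"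

lemma correction_const_nonneg: "0 \<le> r \<Longrightarrow> r < 1 \<Longrightarrow> correction_const r \<ge> 0"
  by (simp add: correction_const_def)

lemma correction_const_sums:
  assumes "0 \<le> r" "r < 1"
  shows "(\<lambda>j. (real j + 3) * r ^ j) sums correction_const r"
proof -
  have "(\<lambda>j. real (Suc j) * r ^ j + 2 * r ^ j) sums correction_const r"
    unfolding correction_const_def using assms
    by (intro sums_add geometric_deriv_sums sums_mult geometric_sums) auto
  then show ?thesis by (simp add: algebra_simps)
qed

text \<open>The linear term of \<open>(1 - X)\<^sup>z (1 + z X / (1 - X))\<close> cancels, whence the exponent \<open>2 n\<close>.\<close>

lemma fps_abs_bound_correction:
  assumes z: "norm z = 1" and n: "n > 0" and r: "0 \<le> r" "r < 1"
  shows "fps_abs_bound (correction_series z oo fps_X ^ n) r (1 + correction_const r * r ^ (2 * n))"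
  unfolding fps_abs_bound_def
proof
  fix N
  define c where "c = (\<lambda>k. norm (correction_series z $ k))"
  define x where "x = r ^ n"
  have x: "0 \<le> x" "x \<le> r" using r n by (auto simp: x_def power_le_one_iff intro: power_le_imp_le_base)
      (metis less_eq_real_def power_decreasing power_one_right Suc_leI One_nat_def)
  have "(\<Sum>m\<le>N. norm ((correction_series z oo fps_X ^ n) $ m) * r ^ m) =
      (\<Sum>m | m \<le> N \<and> n dvd m. c (m div n) * r ^ m)"
    by (intro sum.mono_neutral_cong_right) (auto simp: fps_compose_X_power_nth[OF n] c_def)
  also have "{m. m \<le> N \<and> n dvd m} = (\<lambda>k. n * k) ` {k. n * k \<le> N}" by auto
  also have "(\<Sum>m\<in>\<dots>. c (m div n) * r ^ m) = (\<Sum>k | n * k \<le> N. c k * x ^ k)"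
    using n by (subst sum.reindex) (auto simp: inj_on_def x_def power_mult)
  \<comment> \<open>Extended to N + 2 terms so that indices 0 and 1 can be split off for every N,
    even N = 0.\<close>
  also have "\<dots> \<le> (\<Sum>k<Suc (Suc N). c k * x ^ k)"
  proof (intro sum_mono2)
    show "{k. n * k \<le> N} \<subseteq> {..<Suc (Suc N)}"
    proof
      fix k assume "k \<in> {k. n * k \<le> N}"
      moreover have "1 * k \<le> n * k" using n by (intro mult_right_mono) auto
      ultimately have "k \<le> N" by (metis mem_Collect_eq mult_1 order_trans)
      then show "k \<in> {..<Suc (Suc N)}" by simp
    qed
  qed (use x in \<open>auto simp: c_def\<close>)
  also have "\<dots> = c 0 + c (Suc 0) * x + (\<Sum>k<N. c (Suc (Suc k)) * x ^ Suc (Suc k))"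
    by (simp add: sum.lessThan_Suc_shift del: sum.lessThan_Suc)
  also have "\<dots> \<le> 1 + (\<Sum>k<N. x\<^sup>2 * ((real k + 3) * r ^ k))"
  proof -
    have "c (Suc (Suc k)) * x ^ Suc (Suc k) \<le> x\<^sup>2 * ((real k + 3) * r ^ k)" for k
    proof -
      \<comment> \<open>Only x^2 keeps its dependence on n; in the other powers x = r^n is replaced
        by r, so that one constant serves all degrees.\<close>
      have "c (Suc (Suc k)) * x ^ k \<le> (real k + 3) * r ^ k"
        using norm_correction_series_nth_le[OF z, of "Suc (Suc k)"] x
        by (intro mult_mono power_mono) (auto simp: c_def)
      then have "x\<^sup>2 * (c (Suc (Suc k)) * x ^ k) \<le> x\<^sup>2 * ((real k + 3) * r ^ k)"
        by (intro mult_left_mono) auto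
      then show ?thesis by (simp add: power2_eq_square mult_ac)
    qed
    then show ?thesis
      by (simp add: c_def correction_series_nth_0 correction_series_nth_1 sum_mono)
  qed
  also have "\<dots> \<le> 1 + x\<^sup>2 * correction_const r"
    unfolding sum_distrib_left[symmetric] using correction_const_sums[OF r] r
    by (intro add_left_mono mult_left_mono sum_le_suminf[THEN order_trans])
       (auto simp: sums_iff)
  finally show "(\<Sum>m\<le>N. norm ((correction_series z oo fps_X ^ n) $ m) * r ^ m) \<le> 1 + correction_const r * r ^ (2 * n)"
    by (simp add: x_def mult_ac flip: power_mult)
qed

section \<open>Value of the local correction at a point\<close>

lemma fps_conv_radius_of_bounded:
  assumes "\<And>n. norm (f $ n) \<le> 1"
  shows "fps_conv_radius f \<ge> 1"
  unfolding fps_conv_radius_def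
proof (rule conv_radius_geI_ex')
  fix r :: real assume r: "0 < r" "ereal r < 1"
  show "summable (\<lambda>n. f $ n * of_real r ^ n)"
  proof (rule summable_comparison_test)
    show "summable (\<lambda>n. r ^ n)" using r by (intro summable_geometric) auto
    show "\<exists>N. \<forall>n\<ge>N. norm (f $ n * of_real r ^ n) \<le> r ^ n"
      using assms r by (auto simp: norm_mult norm_power intro!: mult_left_le_one_le)
  qed
qed

lemma correction_series_sums:
  assumes z: "norm z = 1" and y: "0 \<le> y" "y < 1"
  shows "(\<lambda>n. correction_series z $ n * of_real y ^ n) sums
    (of_real (1 - y) powr z * (1 + z * (of_real y / (1 - of_real y))))"
proof -
  have rad: "ereal (norm (complex_of_real y)) < fps_conv_radius (binomial_series z)"
       "ereal (norm (complex_of_real y)) < fps_conv_radius (local_series z)"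
    using y z fps_conv_radius_of_bounded norm_binomial_series_nth_le[OF z] norm_local_series_nth[OF z]
    by (auto intro!: less_le_trans[OF _ fps_conv_radius_of_bounded])
  have "(\<lambda>n. (z gchoose n) * (- of_real y) ^ n) sums (1 + (- of_real y)) powr z"
    using y by (intro gen_binomial_complex) auto
  moreover have "(z gchoose n) * (- of_real y) ^ n = binomial_series z $ n * of_real y ^ n" for n
    by (simp add: binomial_series_nth power_minus[of "complex_of_real y"])
  ultimately have 1: "eval_fps (binomial_series z) (of_real y) = of_real (1 - y) powr z"
    by (simp add: eval_fps_def sums_iff)
  have "(\<lambda>n. z * of_real y ^ n + (if n = 0 then 1 - z else 0)) sums (z * (1 / (1 - of_real y)) + (1 - z))"
    using y by (intro sums_add sums_mult geometric_sums sums_single) auto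
  moreover have "z * of_real y ^ n + (if n = 0 then 1 - z else 0) = local_series z $ n * of_real y ^ n" for n
    by (simp add: local_series_def)
  moreover have "z * (1 / (1 - of_real y)) + (1 - z) = 1 + z * (of_real y / (1 - of_real y))"
  proof -
    have "1 - complex_of_real y \<noteq> 0" using y by (metis eq_iff_diff_eq_0 less_irrefl of_real_1 of_real_eq_iff)
    then show ?thesis by (simp add: divide_simps) (simp add: algebra_simps)
  qed
  ultimately have 2: "eval_fps (local_series z) (of_real y) = 1 + z * (of_real y / (1 - of_real y))"
    by (simp add: eval_fps_def sums_iff)
  have "ereal (norm (complex_of_real y)) < fps_conv_radius (correction_series z)"
    unfolding correction_series_def using rad by (intro less_le_trans[OF _ fps_conv_radius_mult]) auto
  then have "(\<lambda>n. correction_series z $ n * of_real y ^ n) sums eval_fps (correction_series z) (of_real y)"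
    by (rule sums_eval_fps)
  also have "eval_fps (correction_series z) (of_real y) =
      of_real (1 - y) powr z * (1 + z * (of_real y / (1 - of_real y)))"
    unfolding correction_series_def eval_fps_mult[OF rad] 1 2 ..
  finally show ?thesis .
qed

lemma eval_correction_compose:
  assumes z: "norm z = 1" and s: "0 \<le> s" "s < 1" and n: "n > 0"
  shows "eval_fps (correction_series z oo fps_X ^ n) (of_real s) =
    of_real (1 - s ^ n) powr z * (1 + z * (of_real (s ^ n) / (1 - of_real (s ^ n))))"
proof -
  define f where "f = (\<lambda>m. (correction_series z oo fps_X ^ n) $ m * of_real s ^ m)"
  have "(\<lambda>k. f (n * k)) sums
      (of_real (1 - s ^ n) powr z * (1 + z * (of_real (s ^ n) / (1 - of_real (s ^ n)))))"
    using correction_series_sums[OF z, of "s ^ n"] s n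
    by (simp add: f_def fps_compose_X_power_nth power_mult power_less_one_iff)
  moreover have "(\<lambda>k. f (n * k)) sums c \<longleftrightarrow> f sums c" for c
    using n by (intro sums_mono_reindex) (auto simp: strict_mono_def f_def fps_compose_X_power_nth)
  ultimately have "f sums
      (of_real (1 - s ^ n) powr z * (1 + z * (of_real (s ^ n) / (1 - of_real (s ^ n)))))"
    by blast
  then show ?thesis unfolding eval_fps_def f_def by (rule sums_unique[symmetric])
qed

section \<open>The factors at 1/q and bounds over all irreducibles\<close>

lemma CARD_ge_2: "CARD('a::{field,finite}) \<ge> 2"
proof -
  have "card {0, 1 :: 'a} \<le> CARD('a)" by (intro card_mono) auto
  then show ?thesis by simp
qed

text \<open>At T = 1/q the variable X = T^(deg \<pi>) becomes y = 1/|\<pi>|, and 1/(|\<pi>| - 1) =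
  y/(1 - y).\<close>

lemma Phi2_factor_eq_eval:
  fixes \<pi> :: "'a::{field,finite} poly"
  assumes "degree \<pi> > 0"
  shows "Phi2_factor u \<pi> = eval_fps (correction_series (exp (\<i> * of_real u)) oo fps_X ^ degree \<pi>) (of_real (1 / real CARD('a)))"
proof -
  define s where "s = 1 / real CARD('a)"
  have s: "0 \<le> s" "s < 1" "s \<noteq> 0" using CARD_ge_2[where 'a='a] by (auto simp: s_def)
  have abs: "poly_abs \<pi> = 1 / s ^ degree \<pi>" by (simp add: poly_abs_def s_def power_divide)
  define y where "y = s ^ degree \<pi>"
  have y: "y \<noteq> 0" "y < 1" using s assms by (auto simp: y_def power_less_one_iff)
  then have "1 / (1 / y - 1) = y / (1 - y)" by (simp add: field_simps)
  then have "z / of_real (1 / y - 1) = z * of_real (y / (1 - y))" for z :: complex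
    by (metis divide_inverse inverse_eq_divide of_real_inverse)
  then have eq: "z / of_real (1 / y - 1) = z * (of_real y / (1 - of_real y))" for z :: complex
    by simp
  then show ?thesis
    unfolding Phi2_factor_def abs s_def[symmetric] using s assms
    by (subst eval_correction_compose) (simp_all add: eq flip: y_def)
qed

lemma sum_irreducibles_le:
  fixes F :: "'a::{field,finite} poly set" and t :: real
  assumes F: "finite F" "F \<subseteq> monic_irreducibles" and t: "t \<ge> 0" "real CARD('a) * t\<^sup>2 < 1"
  shows "(\<Sum>\<pi>\<in>F. t ^ (2 * degree \<pi>)) \<le> 1 / (1 - real CARD('a) * t\<^sup>2)"
proof -
  define q where "q = real CARD('a)"
  define N where "N = Max (insert 0 (degree ` F))"
  have N: "degree \<pi> \<le> N" if "\<pi> \<in> F" for \<pi> using that F by (auto simp: N_def)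
  have "(\<Sum>\<pi>\<in>F. t ^ (2 * degree \<pi>)) \<le> (\<Sum>\<pi>\<in>(\<Union>n<Suc N. monic_of_degree n :: 'a poly set). t ^ (2 * degree \<pi>))"
  proof (rule sum_mono2)
    show "F \<subseteq> (\<Union>n<Suc N. monic_of_degree n)"
      using F N by (auto simp: monic_of_degree_def monic_irreducibles_def less_Suc_eq_le)
  qed (use t in \<open>auto simp: finite_monic_of_degree\<close>)
  also have "\<dots> = (\<Sum>n<Suc N. \<Sum>\<pi>\<in>(monic_of_degree n :: 'a poly set). t ^ (2 * degree \<pi>))"
    by (intro sum.UNION_disjoint ballI finite_monic_of_degree) (auto simp: monic_of_degree_def)
  also have "\<dots> = (\<Sum>n<Suc N. (q * t\<^sup>2) ^ n)"
  proof (intro sum.cong refl)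
    fix n
    have "(\<Sum>\<pi>\<in>(monic_of_degree n :: 'a poly set). t ^ (2 * degree \<pi>)) = (\<Sum>\<pi>\<in>(monic_of_degree n :: 'a poly set). t ^ (2 * n))"
      by (intro sum.cong) (auto simp: monic_of_degree_def)
    then show "(\<Sum>\<pi>\<in>(monic_of_degree n :: 'a poly set). t ^ (2 * degree \<pi>)) = (q * t\<^sup>2) ^ n"
      by (simp add: card_monic_of_degree q_def power_mult_distrib power_mult)
  qed
  also have "\<dots> \<le> (\<Sum>n. (q * t\<^sup>2) ^ n)"
    using t by (intro sum_le_suminf summable_geometric) (auto simp: q_def)
  also have "\<dots> = 1 / (1 - q * t\<^sup>2)" using t by (intro suminf_geometric) (auto simp: q_def)
  finally show ?thesis by (simp add: q_def)
qed

text \<open>The local bounds 1 + O(r^(2 deg \<pi>)) multiply to something below the exponential of a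
  convergent sum. The result involves neither P nor z, and so holds along the growing truncations
  and for all u at once.\<close>

lemma fps_abs_bound_euler_correction:
  fixes P :: "'a::{field,finite} poly set"
  assumes z: "norm z = 1" and r: "0 \<le> r" "r < 1" "real CARD('a) * r\<^sup>2 < 1"
    and P: "finite P" "P \<subseteq> monic_irreducibles"
  shows "fps_abs_bound (euler_correction z P) r (exp (correction_const r * (1 / (1 - real CARD('a) * r\<^sup>2))))"
proof (rule fps_abs_bound_mono)
  show "fps_abs_bound (euler_correction z P) r (\<Prod>\<pi>\<in>P. 1 + correction_const r * r ^ (2 * degree \<pi>))"
    unfolding euler_correction_def using P monic_irreducible_degree_pos
    by (intro fps_abs_bound_prod fps_abs_bound_correction z r) auto
  have "(\<Prod>\<pi>\<in>P. 1 + correction_const r * r ^ (2 * degree \<pi>)) \<le> exp (\<Sum>\<pi>\<in>P. correction_const r * r ^ (2 * degree \<pi>))"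
    using r correction_const_nonneg by (intro prod_le_exp_sum) auto
  also have "\<dots> \<le> exp (correction_const r * (1 / (1 - real CARD('a) * r\<^sup>2)))"
    unfolding sum_distrib_left[symmetric] exp_le_cancel_iff
    using r P by (intro mult_left_mono sum_irreducibles_le correction_const_nonneg) auto
  finally show "(\<Prod>\<pi>\<in>P. 1 + correction_const r * r ^ (2 * degree \<pi>)) \<le> exp (correction_const r * (1 / (1 - real CARD('a) * r\<^sup>2)))" .
qed

lemma eval_euler_correction:
  fixes P :: "'a::{field,finite} poly set"
  assumes P: "finite P" "P \<subseteq> monic_irreducibles" and q: "q = real CARD('a)"
  shows "eval_fps (euler_correction (exp (\<i> * of_real u)) P) (of_real (1 / q)) = (\<Prod>\<pi>\<in>P. Phi2_factor u \<pi>)"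
proof -
  define z where "z = exp (\<i> * complex_of_real u)"
  have z: "norm z = 1" by (simp add: z_def)
  define s where "s = 1 / q"
  have s: "0 < s" "s < 1" using CARD_ge_2[where 'a='a] by (auto simp: s_def q)
  \<comment> \<open>A radius strictly beyond s puts s inside the disc of convergence, where
    evaluation is multiplicative.\<close>
  obtain r where r: "s < r" "r < 1" using s dense by blast
  have rad: "ereal (norm (complex_of_real s)) < fps_conv_radius (\<Prod>\<pi>\<in>F. correction_series z oo fps_X ^ degree \<pi>)"
    if "F \<subseteq> P" for F
  proof -
    have "fps_abs_bound (\<Prod>\<pi>\<in>F. correction_series z oo fps_X ^ degree \<pi>) r
        (\<Prod>\<pi>\<in>F. 1 + correction_const r * r ^ (2 * degree \<pi>))"
      using P monic_irreducible_degree_pos that r s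
      by (intro fps_abs_bound_prod fps_abs_bound_correction z) auto
    then have "ereal r \<le> fps_conv_radius (\<Prod>\<pi>\<in>F. correction_series z oo fps_X ^ degree \<pi>)"
      using r s by (intro fps_abs_bound_conv_radius) auto
    moreover have "ereal (norm (complex_of_real s)) < ereal r" using r s by simp
    ultimately show ?thesis by (rule less_le_trans[rotated])
  qed
  have "eval_fps (\<Prod>\<pi>\<in>F. correction_series z oo fps_X ^ degree \<pi>) (of_real s) = (\<Prod>\<pi>\<in>F. Phi2_factor u \<pi>)"
    if "finite F" "F \<subseteq> P" for F
    using that
  proof (induction F rule: finite_induct)
    case (insert \<pi> F)
    have "degree \<pi> > 0" using insert.prems P monic_irreducible_degree_pos by auto
    then have "Phi2_factor u \<pi> = eval_fps (correction_series z oo fps_X ^ degree \<pi>) (of_real s)"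
      unfolding z_def s_def q by (rule Phi2_factor_eq_eval)
    moreover have "eval_fps ((correction_series z oo fps_X ^ degree \<pi>) * (\<Prod>\<pi>\<in>F. correction_series z oo fps_X ^ degree \<pi>)) (of_real s)
        = eval_fps (correction_series z oo fps_X ^ degree \<pi>) (of_real s) * (\<Prod>\<pi>\<in>F. Phi2_factor u \<pi>)"
      using insert.prems insert.IH rad[of F] rad[of "{\<pi>}"] by (subst eval_fps_mult) auto
    ultimately show ?case by (simp only: prod.insert[OF insert.hyps])
  qed auto
  then show ?thesis using P by (simp add: euler_correction_def z_def s_def)
qed

lemma Phi2_factor_minus_1_le:
  fixes \<pi> :: "'a::{field,finite} poly"
  assumes "\<pi> \<in> monic_irreducibles"
  defines "s \<equiv> 1 / real CARD('a)"
  shows "norm (Phi2_factor u \<pi> - 1) \<le> correction_const s * s ^ (2 * degree \<pi>)"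
proof -
  define z where "z = exp (\<i> * complex_of_real u)"
  have s: "0 < s" "s < 1" using CARD_ge_2[where 'a='a] by (auto simp: s_def)
  have d: "degree \<pi> > 0" using assms monic_irreducible_degree_pos by blast
  have "fps_abs_bound (correction_series z oo fps_X ^ degree \<pi>) s (1 + correction_const s * s ^ (2 * degree \<pi>))"
    using d s by (intro fps_abs_bound_correction) (auto simp: z_def)
  \<comment> \<open>With r = s the ratio s / r is 1, and subtracting the constant term 1 from the
    bound leaves exactly the claim.\<close>
  from eval_fps_tail_le[OF this, of s 1] show ?thesis
    using s unfolding Phi2_factor_eq_eval[OF d] z_def s_def[symmetric]
    by (simp add: correction_series_nth_0)
qed

lemma summable_Phi2_bound:
  fixes c :: real
  defines "s \<equiv> 1 / real CARD('a::{field,finite})"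
  shows "(\<lambda>\<pi>. c * s ^ (2 * degree \<pi>)) summable_on (monic_irreducibles :: 'a poly set)"
proof (intro summable_on_cmult_right nonneg_bdd_above_summable_on)
  have "real CARD('a) * s\<^sup>2 = s" by (simp add: s_def power2_eq_square)
  moreover have s: "0 < s" "s < 1" using CARD_ge_2[where 'a='a] by (auto simp: s_def)
  ultimately have "(\<Sum>\<pi>\<in>F. s ^ (2 * degree \<pi>)) \<le> 1 / (1 - s)"
    if "finite F" "F \<subseteq> monic_irreducibles" for F :: "'a poly set"
    using sum_irreducibles_le[OF that, of s] by auto
  then show "bdd_above (sum (\<lambda>\<pi>. s ^ (2 * degree \<pi>)) ` {F. F \<subseteq> (monic_irreducibles :: 'a poly set) \<and> finite F})"
    by (intro bdd_aboveI[of _ "1 / (1 - s)"]) auto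
qed (auto simp: s_def)

section \<open>The normalised sum and its limit\<close>

lemma filterlim_irreducibles_upto:
  "filterlim (irreducibles_upto :: nat \<Rightarrow> 'a::{field,finite} poly set) (finite_subsets_at_top monic_irreducibles) sequentially"
  unfolding filterlim_finite_subsets_at_top
proof (intro allI impI)
  fix X :: "'a poly set" assume X: "finite X \<and> X \<subseteq> monic_irreducibles"
  show "\<forall>\<^sub>F d in sequentially. finite (irreducibles_upto d :: 'a poly set) \<and> X \<subseteq> irreducibles_upto d \<and> irreducibles_upto d \<subseteq> (monic_irreducibles :: 'a poly set)"
    using eventually_ge_at_top[of "Max (degree ` X)"]
  proof eventually_elim
    case (elim d)
    have "degree \<pi> \<le> d" if "\<pi> \<in> X" for \<pi>
    proof -
      have "degree \<pi> \<le> Max (degree ` X)" using that X by (intro Max_ge) auto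
      then show ?thesis using elim by linarith
    qed
    then show ?case using X finite_irreducibles_upto[where 'a = 'a, of d] by (auto simp: irreducibles_upto_def)
  qed
qed

text \<open>The quotient q^(d-m) / q^d = (1/q)^m turns the convolution into the correction series at
  1/q, cut after degree d, with each term weighted by a shifted coefficient. Once these weights are
  replaced by their common limit, only a truncated value of the correction remains.\<close>

lemma normalized_sum_eq:
  fixes u :: real and d :: nat
  defines "q \<equiv> CARD('a::{field,finite})" and "z \<equiv> exp (\<i> * complex_of_real u)"
  shows "exp ((1 - z) * complex_of_real (ln (real d))) / of_nat q ^ d *
      (\<Sum>f\<in>(monic_of_degree d :: 'a poly set). exp (\<i> * complex_of_real u * (of_nat (omega f) - 1))) =
    (\<Sum>m\<le>d. euler_correction z (irreducibles_upto d :: 'a poly set) $ m * of_real (1 / real q) ^ m * shifted_coeff z d m)"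
proof -
  define g where "g = (\<lambda>m. euler_correction z (irreducibles_upto d :: 'a poly set) $ m)"
  have q: "of_nat q \<noteq> (0 :: complex)" by (simp add: q_def)
  have "exp (\<i> * complex_of_real u * (of_nat (omega f) - 1)) = z ^ omega f / z" for f :: "'a poly"
  proof -
    have "\<i> * complex_of_real u * (of_nat (omega f) - 1) = of_nat (omega f) * (\<i> * complex_of_real u) - \<i> * complex_of_real u"
      by (simp add: algebra_simps)
    then show ?thesis by (simp only: exp_diff exp_of_nat_mult z_def)
  qed
  then have "(\<Sum>f\<in>(monic_of_degree d :: 'a poly set). exp (\<i> * complex_of_real u * (of_nat (omega f) - 1))) =
      (\<Sum>f\<in>(monic_of_degree d :: 'a poly set). z ^ omega f) / z"
    by (simp add: sum_divide_distrib)
  also have "\<dots> = (\<Sum>m\<le>d. g m * (of_nat q ^ (d - m) * (pochhammer z (d - m) / fact (d - m)))) / z"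
    unfolding sum_power_omega_eq g_def q_def ..
  finally have eq: "(\<Sum>f\<in>(monic_of_degree d :: 'a poly set). exp (\<i> * complex_of_real u * (of_nat (omega f) - 1))) = \<dots>" .
  show ?thesis
    unfolding eq sum_divide_distrib sum_distrib_left g_def[symmetric]
  proof (intro sum.cong refl)
    fix m assume "m \<in> {..d}"
    then have "of_nat q ^ d = (of_nat q ^ (d - m) * of_nat q ^ m :: complex)"
      by (simp flip: power_add)
    then show "exp ((1 - z) * complex_of_real (ln (real d))) / of_nat q ^ d *
        (g m * (of_nat q ^ (d - m) * (pochhammer z (d - m) / fact (d - m))) / z) =
        g m * of_real (1 / real q) ^ m * shifted_coeff z d m"
      using q by (simp add: shifted_coeff_def power_divide divide_simps)
  qed
qed

theorem theorem6p1:
  fixes p q k :: nat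
  assumes "prime p" and "q = p ^ k" and "q \<noteq> 1"
    and "CARD('a::{field,finite}) = q"
  shows "let S = (\<lambda>u d.
            exp ((1 - exp (\<i> * complex_of_real u)) * complex_of_real (ln (real d))) / of_nat q ^ d *
            (\<Sum>f\<in>(monic_of_degree d :: 'a poly set).
               exp (\<i> * complex_of_real u * (of_nat (omega f) - 1))) :: complex)
    in (\<forall>u::real. uprod_convergent (Phi2_factor u) (monic_irreducibles :: 'a poly set)) \<and>
       (\<forall>u::real. (\<lambda>d. S u d) \<longlonglongrightarrow> Phi1 u * Phi2 TYPE('a) u) \<and>
       uniform_limit (UNIV :: real set) (\<lambda>d u. S u d) (\<lambda>u. Phi1 u * Phi2 TYPE('a) u) sequentially"
proof -
  define S where "S = (\<lambda>u d.
            exp ((1 - exp (\<i> * complex_of_real u)) * complex_of_real (ln (real d))) / of_nat q ^ d *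
            (\<Sum>f\<in>(monic_of_degree d :: 'a poly set).
               exp (\<i> * complex_of_real u * (of_nat (omega f) - 1))) :: complex)"
  define s where "s = 1 / real q"
  define M where "M = (\<lambda>\<pi>::'a poly. correction_const s * s ^ (2 * degree \<pi>))"
  have q: "real q \<ge> 2" using CARD_ge_2[where 'a='a] assms(4) by simp
  have s: "0 < s" "s < 1" using q by (auto simp: s_def)
  have le: "norm (Phi2_factor u \<pi> - 1) \<le> M \<pi>" if "\<pi> \<in> monic_irreducibles" for u and \<pi> :: "'a poly"
    using Phi2_factor_minus_1_le[OF that] by (simp add: M_def s_def assms(4))
  have M: "M summable_on monic_irreducibles"
    using summable_Phi2_bound[where 'a='a] by (simp add: M_def s_def assms(4))
  \<comment> \<open>The partial product over degrees up to d equals the value at 1/q of the very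
    correction series that occurs in S at d. This ties the two truncations together.\<close>
  define Q where "Q = (\<lambda>d u. \<Prod>\<pi>\<in>(irreducibles_upto d :: 'a poly set). Phi2_factor u \<pi>)"
  have Q: "uniform_limit UNIV Q (Phi2 TYPE('a)) sequentially"
    unfolding Q_def Phi2_def
    using uprod_uniform_limit[where f = Phi2_factor, OF le M] filterlim_irreducibles_upto
    by (rule filterlim_compose)
  have "1 / real q < 1 / sqrt (real q)"
    using q by (intro divide_strict_left_mono) (auto simp: real_less_lsqrt power2_eq_square intro!: real_sqrt_less_iff[THEN iffD1])
  then obtain r where r: "s < r" "r < 1 / sqrt (real q)" using dense unfolding s_def by blast
  have "r\<^sup>2 < (1 / sqrt (real q))\<^sup>2" using r s by (intro power_strict_mono) auto
  then have qr: "real q * r\<^sup>2 < 1" using q by (simp add: power_divide field_simps)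
  have "1 / sqrt (real q) \<le> 1" using q by simp
  then have r1: "r < 1" using r by linarith
  \<comment> \<open>The gain from evaluating inside the radius r: |g_m| s^m = (|g_m| r^m) \<rho>^m,
    where the first factors sum to at most B.\<close>
  define \<rho> where "\<rho> = s / r"
  have \<rho>: "0 < \<rho>" "\<rho> < 1" using r s by (auto simp: \<rho>_def)
  define z where "z = (\<lambda>u. exp (\<i> * complex_of_real u))"
  have z: "norm (z u) = 1" for u by (simp add: z_def)
  define B where "B = exp (correction_const r * (1 / (1 - real q * r\<^sup>2)))"
  define C where "C = scaled_coeff_bound"
  have C: "C \<ge> 1" using scaled_coeff_bound_ge_1 by (simp add: C_def)
  have BC: "B > 0" "C > 0" using C by (auto simp: B_def)
  have Phi1: "Phi1 u = rGamma (z u + 1)" "norm (Phi1 u) \<le> C" for u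
    using norm_rGamma_le_scaled_coeff_bound[OF z] by (auto simp: Phi1_def z_def C_def)
  define g where "g = (\<lambda>d u m. euler_correction (z u) (irreducibles_upto d :: 'a poly set) $ m)"
  have bound: "fps_abs_bound (euler_correction (z u) (irreducibles_upto d :: 'a poly set)) r B" for u d
    using fps_abs_bound_euler_correction[OF z, of r "irreducibles_upto d :: 'a poly set"] r r1 s qr
      irreducibles_upto_subset[of d] by (simp add: B_def assms(4))
  have S_eq: "S u d = (\<Sum>m\<le>d. g d u m * of_real s ^ m * shifted_coeff (z u) d m)" for u d
    using normalized_sum_eq[where 'a='a, of u d] by (simp only: S_def g_def z_def s_def assms(4))
  have lim: "uniform_limit UNIV (\<lambda>d u. S u d) (\<lambda>u. Phi1 u * Phi2 TYPE('a) u) sequentially"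
  proof (rule uniform_limitI)
    fix e :: real assume e: "e > 0"
    \<comment> \<open>Three errors of e/3 each: cutting the correction series after degree d,
      replacing shifted coefficients by \<open>Phi1 u\<close>, and truncating the infinite product.
      The second is later summed against B and the third multiplied by |\<open>Phi1 u\<close>| \<le>
      C, whence the divisions.\<close>
    have "(\<lambda>d. C * (\<rho> ^ Suc d * B)) \<longlonglongrightarrow> C * (0 * B)"
      using \<rho> by (intro tendsto_intros LIMSEQ_Suc LIMSEQ_power_zero) auto
    then have "\<forall>\<^sub>F d in sequentially. C * (\<rho> ^ Suc d * B) < e / 3"
      by (rule order_tendstoD) (use e in simp)
    moreover have "\<forall>\<^sub>F d in sequentially. \<forall>z m. norm z = 1 \<longrightarrow> m \<le> d \<longrightarrow>
        \<rho> ^ m * norm (shifted_coeff z d m - rGamma (z + 1)) < e / 3 / B"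
      using e BC by (intro weighted_shifted_coeff_limit \<rho>) auto
    moreover have "\<forall>\<^sub>F d in sequentially. \<forall>u\<in>UNIV. dist (Q d u) (Phi2 TYPE('a) u) < e / 3 / C"
    proof -
      have "e / 3 / C > 0" using e BC by simp
      then show ?thesis using Q unfolding uniform_limit_iff by blast
    qed
    ultimately show "\<forall>\<^sub>F d in sequentially. \<forall>u\<in>UNIV. dist (S u d) (Phi1 u * Phi2 TYPE('a) u) < e"
    proof eventually_elim
      case (elim d)
      show ?case
      proof
        fix u :: real
        \<comment> \<open>The correction series at 1/q cut after degree d, the intermediary between
          S, which sees only these coefficients, and the full value Q.\<close>
        define T where "T = (\<Sum>m<Suc d. g d u m * of_real s ^ m)"
        have 1: "norm (S u d - Phi1 u * T) \<le> e / 3"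
        proof -
          have "S u d - Phi1 u * T = (\<Sum>m\<le>d. g d u m * of_real s ^ m * (shifted_coeff (z u) d m - Phi1 u))"
            unfolding S_eq T_def lessThan_Suc_atMost by (simp add: sum_distrib_left sum_subtractf algebra_simps)
          also have "norm \<dots> \<le> (\<Sum>m\<le>d. (norm (g d u m) * r ^ m) * (e / 3 / B))"
          proof (rule order_trans[OF norm_sum], intro sum_mono)
            fix m assume "m \<in> {..d}"
            then have "\<rho> ^ m * norm (shifted_coeff (z u) d m - Phi1 u) \<le> e / 3 / B"
              using elim(2) z[of u] by (force simp: Phi1(1))
            moreover have "s = \<rho> * r" using r s by (simp add: \<rho>_def)
            ultimately show "norm (g d u m * of_real s ^ m * (shifted_coeff (z u) d m - Phi1 u)) \<le> (norm (g d u m) * r ^ m) * (e / 3 / B)"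
              using r s \<rho> mult_left_mono[of "\<rho> ^ m * norm (shifted_coeff (z u) d m - Phi1 u)" "e / 3 / B" "norm (g d u m) * r ^ m"]
              by (simp add: norm_mult norm_power power_mult_distrib mult_ac)
          qed
          also have "\<dots> \<le> B * (e / 3 / B)"
            unfolding sum_distrib_right[symmetric] using bound[of u d] e BC
            by (intro mult_right_mono) (auto simp: fps_abs_bound_def g_def)
          finally show ?thesis using BC by simp
        qed
        have 2: "norm (Phi1 u * (T - Q d u)) < e / 3"
        proof -
          have "Q d u = eval_fps (euler_correction (z u) (irreducibles_upto d :: 'a poly set)) (of_real s)"
            unfolding Q_def z_def s_def
            by (subst eval_euler_correction) (auto simp: irreducibles_upto_subset assms(4))
          then have "norm (Q d u - T) \<le> \<rho> ^ Suc d * (B - (\<Sum>m<Suc d. norm (g d u m) * r ^ m))"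
            unfolding T_def g_def \<rho>_def using r s by (simp only:) (intro eval_fps_tail_le bound; simp)
          also have "\<dots> \<le> \<rho> ^ Suc d * B"
            using \<rho> r s by (intro mult_left_mono) (auto intro!: sum_nonneg simp del: sum.lessThan_Suc)
          finally have "norm (Phi1 u) * norm (T - Q d u) \<le> C * (\<rho> ^ Suc d * B)"
            using Phi1(2) BC by (intro mult_mono) (auto simp: norm_minus_commute)
          then show ?thesis using elim(1) by (simp add: norm_mult)
        qed
        have 3: "norm (Phi1 u * (Q d u - Phi2 TYPE('a) u)) < e / 3"
        proof -
          have "norm (Phi1 u) * norm (Q d u - Phi2 TYPE('a) u) \<le> C * norm (Q d u - Phi2 TYPE('a) u)"
            using Phi1(2) by (intro mult_right_mono) auto
          also have "\<dots> < C * (e / 3 / C)"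
            using elim(3) BC by (intro mult_strict_left_mono) (auto simp: dist_norm)
          finally show ?thesis using BC by (simp add: norm_mult)
        qed
        have "S u d - Phi1 u * Phi2 TYPE('a) u =
            (S u d - Phi1 u * T) + Phi1 u * (T - Q d u) + Phi1 u * (Q d u - Phi2 TYPE('a) u)"
          by (simp add: algebra_simps)
        then have "norm (S u d - Phi1 u * Phi2 TYPE('a) u) =
            norm ((S u d - Phi1 u * T) + Phi1 u * (T - Q d u) + Phi1 u * (Q d u - Phi2 TYPE('a) u))"
          by (rule arg_cong)
        then have "norm (S u d - Phi1 u * Phi2 TYPE('a) u) \<le>
            norm (S u d - Phi1 u * T) + norm (Phi1 u * (T - Q d u)) + norm (Phi1 u * (Q d u - Phi2 TYPE('a) u))"
          using norm_triangle_ineq[of "S u d - Phi1 u * T" "Phi1 u * (T - Q d u)"]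
            norm_triangle_ineq[of "(S u d - Phi1 u * T) + Phi1 u * (T - Q d u)" "Phi1 u * (Q d u - Phi2 TYPE('a) u)"]
          by linarith
        then show "dist (S u d) (Phi1 u * Phi2 TYPE('a) u) < e"
          using 1 2 3 by (simp add: dist_norm)
      qed
    qed
  qed
  moreover have "(\<lambda>d. S u d) \<longlonglongrightarrow> Phi1 u * Phi2 TYPE('a) u" for u
    using tendsto_uniform_limitI[OF lim, of u] by simp
  moreover have "uprod_convergent (Phi2_factor u) (monic_irreducibles :: 'a poly set)" for u
    by (rule uprod_convergent_summable[OF le M])
  ultimately show ?thesis unfolding Let_def S_def by blast
qed

end
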